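(* Let $G$ be a unicyclic graph of order $n\geq 6$ such that $G\ncong H(n,4;n-4,0,0,0)$ and $G$ is not isomorphic to any $H(n,3;n_1,n_2,n_3)$. Then $ABC_3(G)\leq (n-1)\sqrt{\tfrac12}+f(3,3)$, with equality if and only if $G$ is isomorphic to one of: $H(n,5;n-5,0,0,0,0)$; $H(n,4;n_1,n-n_1-4,0,0)$ for some integer $n_1$ with $n_1\geq 1$ and $n-n_1-4\geq1$; or $H^t(n,3;n-t-3,0,0)$ for some integer $t$ with $t\geq 1$ and $n-t-3\geq 1$.
   Context: All graphs are simple and connected. For a vertex $u$ of a graph $G$, the eccentricity $e_G(u)$ is $\max\{d_G(u,v): v\in V(G)\}$, where $d_G$ is the shortest-path distance. For real $x,y\geq 1$, $f(x,y)=\sqrt{\frac{x+y-2}{xy}}$, and $ABC_3(G)=\sum_{uv\in E(G)} f(e_G(u),e_G(v))$. A unicyclic graph is a connected graph with exactly one cycle. For nonnegative integers $n_1,\ldots,n_k$ with $\sum_i n_i=n-k$, $H(n,k;n_1,\ldots,n_k)$ is the graph of order $n$ obtained from the cycle $C_k=v_1v_2\cdots v_kv_1$ by attaching $n_i$ new pendent vertices to $v_i$ for each $i$. For integers $m,t\geq 1$ with $n=3+m+t$, $H^t(n,3;m,0,0)$ is the graph of order $n$ obtained from the triangle $v_1v_2v_3v_1$ by attaching $m$ new pendent vertices to $v_1$ and then attaching $t$ further new pendent vertices to one of those $m$ pendent vertices. *)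

theory Defs
  imports Complex_Main "Graph_Theory.Graph_Theory"
begin

text \<open>
  A simple graph is a \<^locale>\<open>pair_graph\<close>: finite, loop-free, without parallel arcs and symmetric,
  so that each undirected edge \<open>uv\<close> is represented by the two arcs \<open>(u, v)\<close> and \<open>(v, u)\<close>.
\<close>

text \<open>
  A cycle is identified with its set of undirected edges, since the closed walks of
  \<^const>\<open>pre_digraph.cycle\<close> carry a starting point and a direction. The bound on the length
  excludes the closed walks that go back and forth along a single edge.
\<close>

definition cycles :: "'a pair_pre_digraph \<Rightarrow> 'a set set set" where
  "cycles G =
    {(\<lambda>(u, v). {u, v}) ` set p | p. pre_digraph.cycle (with_proj G) p \<and> length p \<ge> 3}"

definition unicyclic :: "'a pair_pre_digraph \<Rightarrow> bool" where
  "unicyclic G \<longleftrightarrow>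
    pair_graph G \<and> Digraph_Component.connected (with_proj G) \<and> (\<exists>!C. C \<in> cycles G)"

definition gdist :: "'a pair_pre_digraph \<Rightarrow> 'a \<Rightarrow> 'a \<Rightarrow> real" where
  "gdist G u v = real_of_ereal (wf_digraph.\<mu> (with_proj G) (\<lambda>_. 1) u v)"

definition ecc :: "'a pair_pre_digraph \<Rightarrow> 'a \<Rightarrow> real" where
  "ecc G u = Max {gdist G u v | v. v \<in> pverts G}"

definition abc_f :: "real \<Rightarrow> real \<Rightarrow> real" where
  "abc_f x y = sqrt ((x + y - 2) / (x * y))"

text \<open>The factor 2 accounts for the two arcs of each edge; note that \<open>abc_f\<close> is symmetric.\<close>

definition ABC3 :: "'a pair_pre_digraph \<Rightarrow> real" where
  "ABC3 G = (\<Sum>(u, v)\<in>parcs G. abc_f (ecc G u) (ecc G v)) / 2"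

definition graph_iso :: "'a pair_pre_digraph \<Rightarrow> 'b pair_pre_digraph \<Rightarrow> bool" where
  "graph_iso G H \<longleftrightarrow> digraph_iso (with_proj G) (with_proj H)"

text \<open>
  \<open>cycle_pendants [n\<^sub>1, \<dots>, n\<^sub>k]\<close> is \<open>H(n, k; n\<^sub>1, \<dots>, n\<^sub>k)\<close> with \<open>n = k + n\<^sub>1 + \<dots> + n\<^sub>k\<close>, for
  \<open>k \<ge> 3\<close>. The cycle vertex \<open>v\<^sub>i\<close> is \<open>(i - 1, 0)\<close> and its pendent vertices are
  \<open>(i - 1, j)\<close> for \<open>1 \<le> j \<le> n\<^sub>i\<close>.
\<close>

definition cycle_pendants :: "nat list \<Rightarrow> (nat \<times> nat) pair_pre_digraph" where
  "cycle_pendants ns = \<lparr>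
     pverts = {(i, j). i < length ns \<and> j \<le> ns ! i},
     parcs = symcl ({((i, 0), (Suc i mod length ns, 0)) | i. i < length ns} \<union>
                    {((i, 0), (i, j)) | i j. i < length ns \<and> 1 \<le> j \<and> j \<le> ns ! i}) \<rparr>"

text \<open>
  \<open>triangle_pendants_ext t m\<close> is \<open>H\<^sup>t(n, 3; m, 0, 0)\<close> with \<open>n = 3 + m + t\<close>, for \<open>m \<ge> 1\<close>. The
  \<open>t\<close> further vertices are \<open>(3, j)\<close> for \<open>1 \<le> j \<le> t\<close>, attached to the pendent vertex \<open>(0, 1)\<close>.
\<close>

definition triangle_pendants_ext :: "nat \<Rightarrow> nat \<Rightarrow> (nat \<times> nat) pair_pre_digraph" where
  "triangle_pendants_ext t m = (let T = cycle_pendants [m, 0, 0] in \<lparr>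
     pverts = pverts T \<union> {(3, j) | j. 1 \<le> j \<and> j \<le> t},
     parcs = parcs T \<union> symcl {((0, 1), (3, j)) | j. 1 \<le> j \<and> j \<le> t} \<rparr>)"

end

theory Submission
  imports Defs
begin

text \<open>
  An edge contributes at most \<open>\<surd>(1/2)\<close>, with equality if one end has eccentricity 2, and an edge
  both of whose ends have eccentricity at least 3 (a far edge) contributes at most
  \<open>f(3,3) < \<surd>(1/2)\<close>. There are at most \<open>n\<close> edges, since every edge outside a spanning tree closes its own
  cycle. So a graph with at most \<open>n - 1\<close> edges or with two far edges lies strictly below the
  bound, and a graph with \<open>n\<close> edges attains it if exactly one edge is far and both ends of that edge
  have eccentricity 3.

  It remains to see which graphs with \<open>n\<close> edges have at most one far edge. Such a graph has a vertex
  \<open>c\<close> of eccentricity at most 2, and consists of a breadth-first tree of depth 2 rooted at \<open>c\<close> and one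
  further edge \<open>xy\<close>. If \<open>w\<close> is pendent at \<open>u\<close>, then every vertex other than \<open>u\<close> and \<open>w\<close> that is not
  adjacent to \<open>u\<close> has distance at least 3 from \<open>w\<close>. Applied to the leaves of the tree, this leaves
  only the graphs named in the statement, for each position of \<open>x\<close> and \<open>y\<close> in the tree.
\<close>

section \<open>Graph isomorphisms and symmetric closures\<close>

lemma graph_isoE:
  assumes "graph_iso G H"
  obtains g where "pair_wf_digraph G" "bij_betw g (pverts G) (pverts H)"
    "parcs H = map_prod g g ` parcs G"
proof -
  obtain f where iso: "pre_digraph.digraph_isomorphism (with_proj G) f"
    and H: "with_proj H = app_iso f (with_proj G)"
    using assms unfolding graph_iso_def digraph_iso_def by blast
  have proj: "iso_tail f = fst" "iso_head f = snd" and verts: "pverts H = iso_verts f ` pverts G"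
    and arcs: "parcs H = iso_arcs f ` parcs G"
    using arg_cong[OF H, of tail] arg_cong[OF H, of head] arg_cong[OF H, of verts]
      arg_cong[OF H, of arcs] by auto
  have "parcs H = map_prod (iso_verts f) (iso_verts f) ` parcs G"
    unfolding arcs using iso proj
    by (intro image_cong) (auto simp: pre_digraph.digraph_isomorphism_def prod_eq_iff)
  then show thesis
    using iso verts
    by (intro that[of "iso_verts f"])
      (auto simp: pre_digraph.digraph_isomorphism_def wf_digraph_wp_iff bij_betw_def)
qed

lemma graph_isoI:
  assumes "pair_wf_digraph G" and g: "bij_betw g (pverts G) (pverts H)"
    and arcs: "parcs H = map_prod g g ` parcs G"
  shows "graph_iso G H"
proof -
  interpret G: pair_wf_digraph G by fact
  let ?f = "\<lparr>iso_verts = g, iso_arcs = map_prod g g, iso_head = snd, iso_tail = fst\<rparr>"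
  have "inj_on (map_prod g g) (pverts G \<times> pverts G)"
    using g by (intro map_prod_inj_on) (auto simp: bij_betw_def)
  then have "inj_on (map_prod g g) (parcs G)"
    by (rule inj_on_subset) (auto simp: G.wellformed')
  then have "pre_digraph.digraph_isomorphism (with_proj G) ?f"
    "with_proj H = app_iso ?f (with_proj G)"
    using g arcs G.wf_digraph_axioms
    by (auto simp: pre_digraph.digraph_isomorphism_def bij_betw_def app_iso_def with_proj_def)
  then show ?thesis
    unfolding graph_iso_def digraph_iso_def by blast
qed

lemma graph_iso_sym:
  assumes "graph_iso G H"
  shows "graph_iso H G"
proof -
  have "wf_digraph (with_proj G)"
    using assms by (elim graph_isoE) (simp add: wf_digraph_wp_iff)
  then show ?thesis
    using assms unfolding graph_iso_def by (rule digraph_iso_swap)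
qed

lemma symcl_iff: "(u, v) \<in> symcl R \<longleftrightarrow> (u, v) \<in> R \<or> (v, u) \<in> R"
  by (auto simp: symcl_def)

lemma symcl_Un: "symcl (R \<union> S) = symcl R \<union> symcl S"
  by (auto simp: symcl_def)

lemma map_prod_symcl: "map_prod g g ` symcl R = symcl (map_prod g g ` R)"
  by (auto simp: symcl_def image_Un image_image split_def)

lemma card_symcl:
  assumes "finite R" "asym R"
  shows "card (symcl R) = 2 * card R"
proof -
  have "card ((\<lambda>(u, v). (v, u)) ` R) = card R"
    by (rule card_image) (auto simp: inj_on_def)
  moreover have "R \<inter> (\<lambda>(u, v). (v, u)) ` R = {}"
    using assms(2) by (auto dest: asymD)
  ultimately show ?thesis
    using assms(1) by (simp add: symcl_def card_Un_disjoint)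
qed

section \<open>Pendant extensions\<close>

text \<open>
  The core of a pendant extension is a list of vertices whose arcs are given by pairs of indices, so
  that cores of different graphs can be compared. Every other vertex \<open>v\<close> is pendent at \<open>f v\<close>; the
  values of \<open>f\<close> on the core are irrelevant.
\<close>

definition core_arcs :: "nat rel \<Rightarrow> 'a list \<Rightarrow> 'a rel" where
  "core_arcs E cs = map_prod ((!) cs) ((!) cs) ` E"

definition pendant_extension ::
    "nat rel \<Rightarrow> 'a list \<Rightarrow> ('a \<Rightarrow> 'a) \<Rightarrow> 'a pair_pre_digraph \<Rightarrow> bool" where
  "pendant_extension E cs f G \<longleftrightarrow>
     distinct cs \<and> set cs \<subseteq> pverts G \<and> E \<subseteq> {..<length cs} \<times> {..<length cs} \<and>
     f ` (pverts G - set cs) \<subseteq> set cs \<and>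
     parcs G = symcl (core_arcs E cs \<union> (\<lambda>v. (f v, v)) ` (pverts G - set cs))"

definition pendants :: "('a \<Rightarrow> 'a) \<Rightarrow> 'a list \<Rightarrow> 'a pair_pre_digraph \<Rightarrow> 'a \<Rightarrow> 'a set" where
  "pendants f cs G v = {w \<in> pverts G - set cs. f w = v}"

definition pendant_counts :: "('a \<Rightarrow> 'a) \<Rightarrow> 'a list \<Rightarrow> 'a pair_pre_digraph \<Rightarrow> nat list" where
  "pendant_counts f cs G = map (\<lambda>v. card (pendants f cs G v)) cs"

lemma length_pendant_counts [simp]: "length (pendant_counts f cs G) = length cs"
  by (simp add: pendant_counts_def)

lemma core_arcs_subset:
  "E \<subseteq> {..<length cs} \<times> {..<length cs} \<Longrightarrow> core_arcs E cs \<subseteq> set cs \<times> set cs"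
  by (auto simp: core_arcs_def)

lemma core_arcs_map:
  assumes "E \<subseteq> {..<length cs} \<times> {..<length cs}"
  shows "core_arcs E (map g cs) = map_prod g g ` core_arcs E cs"
  unfolding core_arcs_def image_image using assms by (intro image_cong) auto

lemma pendant_extension_pair_wf_digraph:
  assumes "pendant_extension E cs f G"
  shows "pair_wf_digraph G"
proof -
  have "parcs G \<subseteq> pverts G \<times> pverts G"
    using assms core_arcs_subset[of E cs]
    by (auto simp: pendant_extension_def symcl_def)
  then show ?thesis by unfold_locales auto
qed

lemma UN_pendants:
  assumes "pendant_extension E cs f G"
  shows "(\<Union>v\<in>set cs. insert v (pendants f cs G v)) = pverts G"
proof -
  have "(\<Union>v\<in>set cs. insert v (pendants f cs G v)) =
      set cs \<union> {w \<in> pverts G - set cs. f w \<in> set cs}"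
    by (auto simp: pendants_def)
  then show ?thesis
    using assms by (auto simp: pendant_extension_def)
qed

lemma disjoint_family_on_pendants:
  "disjoint_family_on (\<lambda>v. insert v (pendants f cs G v)) (set cs)"
  by (auto simp: disjoint_family_on_def pendants_def)

lemma card_verts_pendant_extension:
  assumes ext: "pendant_extension E cs f G" and fin: "finite (pverts G)"
  shows "card (pverts G) = length cs + sum_list (pendant_counts f cs G)"
proof -
  have finite_pendants: "finite (pendants f cs G v)" for v
    using fin by (simp add: pendants_def)
  have "card (pverts G) = (\<Sum>v\<in>set cs. card (insert v (pendants f cs G v)))"
    unfolding UN_pendants[OF ext, symmetric]
    by (rule card_UN_disjoint') (simp_all add: disjoint_family_on_pendants finite_pendants)
  also have "\<dots> = (\<Sum>v\<in>set cs. Suc (card (pendants f cs G v)))"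
    using finite_pendants by (intro sum.cong) (auto simp: pendants_def)
  also have "\<dots> = (\<Sum>v\<leftarrow>cs. Suc (card (pendants f cs G v)))"
    using ext by (simp add: pendant_extension_def sum_list_distinct_conv_sum_set)
  finally show ?thesis
    by (simp add: pendant_counts_def sum_list_Suc)
qed

lemma card_arcs_pendant_extension:
  assumes ext: "pendant_extension E cs f G" and fin: "finite (pverts G)"
    and E: "asym E"
  shows "card (parcs G) = 2 * (card E + card (pverts G - set cs))"
proof -
  let ?C = "core_arcs E cs" and ?P = "(\<lambda>v. (f v, v)) ` (pverts G - set cs)"
  note ext_simps = ext[unfolded pendant_extension_def]
  have inj: "inj_on ((!) cs) {..<length cs}"
    using ext_simps by (auto simp: inj_on_nth)
  then have injE: "inj_on (map_prod ((!) cs) ((!) cs)) E"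
    using ext_simps by (intro inj_on_subset[OF map_prod_inj_on[OF inj inj]]) simp
  have "finite E"
    using ext_simps finite_subset by blast
  have C: "?C \<subseteq> set cs \<times> set cs"
    using ext_simps by (intro core_arcs_subset) simp
  have "asym (?C \<union> ?P)"
  proof (intro asymI notI)
    fix u v assume "(u, v) \<in> ?C \<union> ?P" "(v, u) \<in> ?C \<union> ?P"
    then have "(u, v) \<in> ?C" "(v, u) \<in> ?C"
      using C ext_simps by auto
    then obtain i j k l where "(i, j) \<in> E" "(k, l) \<in> E" "cs ! i = cs ! l" "cs ! j = cs ! k"
      by (auto simp: core_arcs_def)
    moreover from this have "i = l" "j = k"
      using inj_onD[OF inj] ext_simps by auto
    ultimately show False
      using E by (auto dest: asymD)
  qed
  moreover have "?C \<inter> ?P = {}"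
    using C by auto
  moreover have "card ?C = card E" "card ?P = card (pverts G - set cs)"
    using injE by (auto simp: core_arcs_def intro!: card_image inj_onI)
  ultimately show ?thesis
    using ext_simps \<open>finite E\<close> fin by (simp add: card_symcl card_Un_disjoint core_arcs_def)
qed

lemma pendant_extension_image:
  assumes ext: "pendant_extension E ds h H" and g: "bij_betw g (pverts H) (pverts G)"
    and arcs: "parcs G = map_prod g g ` parcs H"
    and f: "\<And>v. v \<in> pverts H \<Longrightarrow> f (g v) = g (h v)"
  shows "pendant_extension E (map g ds) f G"
    and "pendant_counts f (map g ds) G = pendant_counts h ds H"
proof -
  note ext_simps = ext[unfolded pendant_extension_def]
  have inj: "inj_on g (pverts H)" and V: "g ` pverts H = pverts G"
    using g by (auto simp: bij_betw_def)
  have outer: "pverts G - g ` set ds = g ` (pverts H - set ds)"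
    using inj_on_image_set_diff[OF inj, of "pverts H" "set ds"] ext_simps V by auto
  have "g ` set ds \<subseteq> pverts G" "distinct (map g ds)"
    using V ext_simps inj_on_subset[OF inj] by (auto simp: distinct_map)
  moreover have "(\<lambda>v. (f v, v)) ` g ` (pverts H - set ds) =
      map_prod g g ` (\<lambda>v. (h v, v)) ` (pverts H - set ds)"
    unfolding image_image by (intro image_cong) (auto simp: f)
  moreover have "core_arcs E (map g ds) = map_prod g g ` core_arcs E ds"
    using ext_simps by (simp add: core_arcs_map)
  ultimately show "pendant_extension E (map g ds) f G"
    using ext_simps arcs outer by (auto simp: pendant_extension_def map_prod_symcl image_Un f)
  have "card (pendants f (map g ds) G (g u)) = card (pendants h ds H u)" if "u \<in> set ds" for u
  proof -
    have "g (h w) = g u \<longleftrightarrow> h w = u" if "w \<in> pverts H - set ds" for w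
      using that \<open>u \<in> set ds\<close> ext_simps by (intro inj_on_eq_iff[OF inj]) auto
    then have "pendants f (map g ds) G (g u) = g ` pendants h ds H u"
      by (auto simp: pendants_def f outer)
    then show ?thesis
      using inj_on_subset[OF inj] by (simp add: card_image pendants_def)
  qed
  then show "pendant_counts f (map g ds) G = pendant_counts h ds H"
    by (simp add: pendant_counts_def)
qed

lemma ex_bij_betw_map_eq:
  assumes "distinct xs" "distinct ys" "length xs = length ys"
  shows "\<exists>\<tau>. bij_betw \<tau> (set xs) (set ys) \<and> map \<tau> xs = ys"
proof -
  define \<tau> where "\<tau> x = the (map_of (zip xs ys) x)" for x
  have "map \<tau> xs = ys"
    using assms by (intro nth_equalityI) (simp_all add: \<tau>_def map_of_zip_nth)
  moreover from this have "bij_betw \<tau> (set xs) (set ys)"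
    using assms(2) by (metis bij_betw_def distinct_map list.set_map)
  ultimately show ?thesis by blast
qed

lemma bij_betw_core_pendants:
  assumes G: "pendant_extension E cs f G" and H: "pendant_extension E ds h H"
    and \<tau>: "bij_betw \<tau> (set cs) (set ds)"
    and \<phi>: "\<And>u. u \<in> set cs \<Longrightarrow> bij_betw (\<phi> u) (pendants f cs G u) (pendants h ds H (\<tau> u))"
  shows "bij_betw (\<lambda>v. if v \<in> set cs then \<tau> v else \<phi> (f v) v) (pverts G) (pverts H)"
proof -
  let ?P = "pendants f cs G" and ?Q = "pendants h ds H"
  define g where "g = (\<lambda>v. if v \<in> set cs then \<tau> v else \<phi> (f v) v)"
  have "bij_betw g (\<Union>u\<in>set cs. insert u (?P u)) (\<Union>u\<in>set cs. insert (\<tau> u) (?Q (\<tau> u)))"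
  proof (rule bij_betw_UNION_disjoint)
    show "disjoint_family_on (\<lambda>u. insert (\<tau> u) (?Q (\<tau> u))) (set cs)"
      using bij_betwE[OF \<tau>] bij_betw_imp_inj_on[OF \<tau>]
      by (auto simp: disjoint_family_on_def pendants_def inj_on_eq_iff)
    show "bij_betw g (insert u (?P u)) (insert (\<tau> u) (?Q (\<tau> u)))" if "u \<in> set cs" for u
    proof -
      have "bij_betw g (?P u) (?Q (\<tau> u))"
        using \<phi>[OF that]
        by (rule bij_betw_cong[THEN iffD1, rotated]) (auto simp: g_def pendants_def)
      moreover have "u \<notin> ?P u" "\<tau> u \<notin> ?Q (\<tau> u)" "g u = \<tau> u"
        using that \<tau> by (auto simp: g_def pendants_def bij_betw_def)
      ultimately show ?thesis by (metis notIn_Un_bij_betw Un_insert_right sup_bot_right)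
    qed
  qed
  moreover have "(\<Union>u\<in>set cs. insert (\<tau> u) (?Q (\<tau> u))) = (\<Union>u\<in>set ds. insert u (?Q u))"
    using \<tau> by (simp add: bij_betw_def flip: image_image[of "\<lambda>u. insert u (?Q u)" \<tau>])
  ultimately show ?thesis
    by (simp only: g_def UN_pendants[OF G] UN_pendants[OF H])
qed

lemma pendant_extension_bij_betw:
  assumes G: "pendant_extension E cs f G" "finite (pverts G)"
    and H: "pendant_extension E ds h H" "finite (pverts H)"
    and counts: "pendant_counts f cs G = pendant_counts h ds H"
  obtains g where "bij_betw g (pverts G) (pverts H)" "map g cs = ds"
    "\<And>v. v \<in> pverts G - set cs \<Longrightarrow> h (g v) = g (f v)"
proof -
  let ?P = "pendants f cs G" and ?Q = "pendants h ds H"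
  have dist: "distinct cs" "distinct ds" and len: "length cs = length ds"
    and f: "f ` (pverts G - set cs) \<subseteq> set cs"
    using G(1) H(1) arg_cong[OF counts, of length] by (simp_all add: pendant_extension_def)
  obtain \<tau> where \<tau>: "bij_betw \<tau> (set cs) (set ds)" and map_\<tau>: "map \<tau> cs = ds"
    using ex_bij_betw_map_eq[OF dist len] by blast
  have "card (?P u) = card (?Q (\<tau> u))" if "u \<in> set cs" for u
    using that counts by (auto simp: pendant_counts_def simp flip: map_\<tau>)
  then have "\<exists>\<phi>. bij_betw \<phi> (?P u) (?Q (\<tau> u))" if "u \<in> set cs" for u
    using that G(2) H(2) by (intro finite_same_card_bij) (auto simp: pendants_def)
  then obtain \<phi> where \<phi>: "\<And>u. u \<in> set cs \<Longrightarrow> bij_betw (\<phi> u) (?P u) (?Q (\<tau> u))" by metis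
  define g where "g v = (if v \<in> set cs then \<tau> v else \<phi> (f v) v)" for v
  have "bij_betw g (pverts G) (pverts H)"
    unfolding g_def using G(1) H(1) \<tau> \<phi> by (rule bij_betw_core_pendants)
  moreover have "map g cs = ds"
    using map_\<tau> by (simp add: g_def cong: map_cong)
  moreover have "h (g v) = g (f v)" if "v \<in> pverts G - set cs" for v
  proof -
    have "f v \<in> set cs" "v \<in> ?P (f v)"
      using that f by (auto simp: pendants_def)
    then have "\<phi> (f v) v \<in> ?Q (\<tau> (f v))"
      using \<phi> bij_betwE by blast
    then show ?thesis
      using that \<open>f v \<in> set cs\<close> by (simp add: g_def pendants_def)
  qed
  ultimately show thesis by (rule that)
qed

lemma graph_iso_pendant_extensionI:
  assumes G: "pendant_extension E cs f G" "finite (pverts G)"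
    and H: "pendant_extension E ds h H" "finite (pverts H)"
    and "pendant_counts f cs G = pendant_counts h ds H"
  shows "graph_iso G H"
proof -
  note G_simps = G(1)[unfolded pendant_extension_def]
    and H_simps = H(1)[unfolded pendant_extension_def]
  obtain g where g: "bij_betw g (pverts G) (pverts H)" and ds: "map g cs = ds"
    and h: "\<And>v. v \<in> pverts G - set cs \<Longrightarrow> h (g v) = g (f v)"
    using pendant_extension_bij_betw[OF assms] by blast
  have "g ` set cs = set ds"
    by (simp flip: ds)
  then have outer: "pverts H - set ds = g ` (pverts G - set cs)"
    using g G_simps by (simp add: bij_betw_def inj_on_image_set_diff[of g "pverts G"])
  have "(\<lambda>v. (h v, v)) ` g ` (pverts G - set cs) =
      map_prod g g ` (\<lambda>v. (f v, v)) ` (pverts G - set cs)"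
    unfolding image_image by (intro image_cong) (simp_all add: h)
  moreover have "core_arcs E ds = map_prod g g ` core_arcs E cs"
    using G_simps core_arcs_map[of E cs g] ds by simp
  ultimately have "parcs H = map_prod g g ` parcs G"
    using G_simps H_simps by (simp add: map_prod_symcl image_Un outer)
  then show ?thesis
    using pendant_extension_pair_wf_digraph[OF G(1)] g by (intro graph_isoI)
qed

lemma graph_iso_pendant_extension_iff:
  assumes "finite (pverts G)" and H: "pendant_extension E ds h H" "finite (pverts H)"
  shows "graph_iso G H \<longleftrightarrow>
    (\<exists>cs f. pendant_extension E cs f G \<and> pendant_counts f cs G = pendant_counts h ds H)"
proof
  assume "graph_iso G H"
  then have "graph_iso H G" by (rule graph_iso_sym)
  then obtain g where g: "bij_betw g (pverts H) (pverts G)" "parcs G = map_prod g g ` parcs H"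
    by (rule graph_isoE)
  define f where "f = g \<circ> h \<circ> the_inv_into (pverts H) g"
  have f: "f (g v) = g (h v)" if "v \<in> pverts H" for v
    using g(1) that by (simp add: f_def bij_betw_def the_inv_into_f_f)
  show "\<exists>cs f. pendant_extension E cs f G \<and> pendant_counts f cs G = pendant_counts h ds H"
    using pendant_extension_image[where f = f and h = h, OF H(1) g f] by blast
next
  assume "\<exists>cs f. pendant_extension E cs f G \<and> pendant_counts f cs G = pendant_counts h ds H"
  then show "graph_iso G H"
    using graph_iso_pendant_extensionI assms by metis
qed

lemma image_supports:
  assumes ext: "pendant_extension E cs f G" and fin: "finite (pverts G)"
  shows "f ` (pverts G - set cs) =
    set (map fst (filter (\<lambda>(v, n). n > 0) (zip cs (pendant_counts f cs G))))"
proof -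
  have "f ` (pverts G - set cs) = {v \<in> set cs. card (pendants f cs G v) > 0}"
    using ext fin by (auto simp: pendant_extension_def pendants_def card_gt_0_iff)
  then show ?thesis
    by (force simp: pendant_counts_def zip_map2 zip_same_conv_map)
qed

section \<open>The named graphs as pendant extensions\<close>

definition cycle_core :: "nat \<Rightarrow> nat rel" where
  "cycle_core k = (\<lambda>i. (i, Suc i mod k)) ` {..<k}"

text \<open>
  In \<open>H\<^sup>t(n, 3; m, 0, 0)\<close> the pendent vertex that carries the \<open>t\<close> further ones is counted as a core
  vertex; this leaves \<open>m - 1\<close> vertices pendent at the triangle.
\<close>

definition paw_core :: "nat rel" where
  "paw_core = {(0, 1), (1, 2), (2, 0), (0, 3)}"

lemma Suc_mod_less: "i < k \<Longrightarrow> Suc i mod k < k"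
  by (rule mod_less_divisor) simp

lemma cycle_core_subset: "cycle_core k \<subseteq> {..<k} \<times> {..<k}"
  by (auto simp: cycle_core_def Suc_mod_less)

lemma paw_core_subset: "paw_core \<subseteq> {..<4} \<times> {..<4}"
  by (auto simp: paw_core_def)

lemma asym_cycle_core: "k \<ge> 3 \<Longrightarrow> asym (cycle_core k)"
  by (rule asymI) (auto simp: cycle_core_def mod_Suc split: if_splits)

lemma card_cycle_core: "card (cycle_core k) = k"
  by (simp add: cycle_core_def card_image inj_on_def)

lemma asym_paw_core: "asym paw_core"
  by (rule asymI) (auto simp: paw_core_def)

lemma card_paw_core: "card paw_core = 4"
  by (simp add: paw_core_def)

lemma pendant_extension_cycle_pendants:
  fixes ns :: "nat list"
  defines "cs \<equiv> map (\<lambda>i. (i, 0)) [0..<length ns]" and "f \<equiv> \<lambda>(i, j). (i, 0)"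
  shows "pendant_extension (cycle_core (length ns)) cs f (cycle_pendants ns)"
    and "pendant_counts f cs (cycle_pendants ns) = ns"
proof -
  have V: "pverts (cycle_pendants ns) - set cs = {(i, j). i < length ns \<and> 1 \<le> j \<and> j \<le> ns ! i}"
    by (auto simp: cycle_pendants_def cs_def)
  have "core_arcs (cycle_core (length ns)) cs =
      {((i, 0), (Suc i mod length ns, 0)) | i. i < length ns}"
    by (auto simp: core_arcs_def cycle_core_def cs_def image_image setcompr_eq_image Suc_mod_less
        intro!: image_cong)
  moreover have "(\<lambda>v. (f v, v)) ` (pverts (cycle_pendants ns) - set cs) =
      {((i, 0), (i, j)) | i j. i < length ns \<and> 1 \<le> j \<and> j \<le> ns ! i}"
    unfolding V by (auto simp: f_def image_iff)
  ultimately show "pendant_extension (cycle_core (length ns)) cs f (cycle_pendants ns)"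
    using cycle_core_subset unfolding pendant_extension_def
    by (auto simp: cycle_pendants_def cs_def f_def distinct_map inj_on_def)
  have "pendants f cs (cycle_pendants ns) (i, 0) = Pair i ` {1..ns ! i}" if "i < length ns" for i
  proof -
    have "pendants f cs (cycle_pendants ns) (i, 0) =
        {w \<in> {(i, j). i < length ns \<and> 1 \<le> j \<and> j \<le> ns ! i}. f w = (i, 0)}"
      by (simp only: pendants_def V)
    also have "\<dots> = Pair i ` {1..ns ! i}"
      using that by (auto simp: f_def)
    finally show ?thesis .
  qed
  then show "pendant_counts f cs (cycle_pendants ns) = ns"
    by (intro nth_equalityI) (simp_all add: pendant_counts_def cs_def card_image inj_on_def)
qed

lemma finite_verts_cycle_pendants: "finite (pverts (cycle_pendants ns))"
proof -
  have "pverts (cycle_pendants ns) = (SIGMA i:{..<length ns}. {..ns ! i})"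
    by (auto simp: cycle_pendants_def)
  then show ?thesis by simp
qed

lemma graph_iso_cycle_pendants_iff:
  assumes "finite (pverts G)"
  shows "graph_iso G (cycle_pendants ns) \<longleftrightarrow>
    (\<exists>cs f. pendant_extension (cycle_core (length ns)) cs f G \<and> pendant_counts f cs G = ns)"
  using graph_iso_pendant_extension_iff[OF assms pendant_extension_cycle_pendants(1)
      finite_verts_cycle_pendants]
  by (simp add: pendant_extension_cycle_pendants(2))

lemma card_verts_cycle_pendants:
  assumes "graph_iso G (cycle_pendants ns)" "finite (pverts G)"
  shows "card (pverts G) = length ns + sum_list ns"
proof -
  obtain cs f where "pendant_extension (cycle_core (length ns)) cs f G" "pendant_counts f cs G = ns"
    using assms graph_iso_cycle_pendants_iff by blast
  then show ?thesis
    using card_verts_pendant_extension[of _ cs f G] assms(2) by force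
qed

lemma core_arcs_rotate1:
  "core_arcs (cycle_core (length cs)) (rotate1 cs) = core_arcs (cycle_core (length cs)) cs"
proof -
  let ?k = "length cs" and ?arc = "\<lambda>i. (cs ! i, cs ! (Suc i mod length cs))"
  have "(\<lambda>i. Suc i mod ?k) ` {..<?k} = {..<?k}"
  proof (rule endo_inj_surj)
    show "inj_on (\<lambda>i. Suc i mod ?k) {..<?k}"
      by (auto simp: inj_on_def mod_Suc)
  qed (auto intro: Suc_mod_less)
  have "core_arcs (cycle_core ?k) (rotate1 cs) = (\<lambda>i. ?arc (Suc i mod ?k)) ` {..<?k}"
    unfolding core_arcs_def cycle_core_def image_image
    by (intro image_cong) (simp_all add: nth_rotate1 Suc_mod_less)
  also have "\<dots> = ?arc ` (\<lambda>i. Suc i mod ?k) ` {..<?k}"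
    by (simp add: image_image)
  also have "\<dots> = ?arc ` {..<?k}"
    by (simp only: \<open>_ = {..<?k}\<close>)
  also have "\<dots> = core_arcs (cycle_core ?k) cs"
    by (simp add: core_arcs_def cycle_core_def image_image)
  finally show ?thesis .
qed

lemma pendant_extension_rotate1:
  assumes "pendant_extension (cycle_core k) cs f G" "length cs = k"
  shows "pendant_extension (cycle_core k) (rotate1 cs) f G"
  using assms by (auto simp: pendant_extension_def core_arcs_rotate1)

lemma pendant_counts_rotate1: "pendant_counts f (rotate1 cs) G = rotate1 (pendant_counts f cs G)"
  by (simp add: pendant_counts_def pendants_def rotate1_map)

lemma graph_iso_cycle_pendants_rotate1:
  assumes "graph_iso G (cycle_pendants ns)" "finite (pverts G)"
  shows "graph_iso G (cycle_pendants (rotate1 ns))"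
proof -
  obtain cs f where ext: "pendant_extension (cycle_core (length ns)) cs f G"
    and counts: "pendant_counts f cs G = ns"
    using assms graph_iso_cycle_pendants_iff by blast
  have "length cs = length ns"
    using arg_cong[OF counts, of length] by simp
  then have "pendant_extension (cycle_core (length (rotate1 ns))) (rotate1 cs) f G"
    using pendant_extension_rotate1[OF ext] by simp
  moreover have "pendant_counts f (rotate1 cs) G = rotate1 ns"
    by (simp add: pendant_counts_rotate1 counts)
  ultimately show ?thesis
    unfolding graph_iso_cycle_pendants_iff[OF assms(2)] by blast
qed

lemma core_arcs_simps:
  "core_arcs (cycle_core 3) [a, b, c] = {(a, b), (b, c), (c, a)}"
  "core_arcs (cycle_core 4) [a, b, c, d] = {(a, b), (b, c), (c, d), (d, a)}"
  "core_arcs (cycle_core 5) [a, b, c, d, e] = {(a, b), (b, c), (c, d), (d, e), (e, a)}"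
  "core_arcs paw_core [a, b, c, d] = {(a, b), (b, c), (c, a), (a, d)}"
  by (simp_all add: core_arcs_def cycle_core_def paw_core_def lessThan_nat_numeral lessThan_Suc
      insert_commute)

lemma cycle_pendants_triangle:
  "pverts (cycle_pendants [m, 0, 0]) = {(0, 0), (1, 0), (2, 0)} \<union> Pair 0 ` {1..m}"
  "parcs (cycle_pendants [m, 0, 0]) =
     symcl ({((0, 0), (1, 0)), ((1, 0), (2, 0)), ((2, 0), (0, 0))} \<union>
       (\<lambda>j. ((0, 0), (0, j))) ` {1..m})"
proof -
  show "pverts (cycle_pendants [m, 0, 0]) = {(0, 0), (1, 0), (2, 0)} \<union> Pair 0 ` {1..m}"
    by (auto simp: cycle_pendants_def less_Suc_eq)
  have "{((i, 0::nat), (Suc i mod length [m, 0, 0], 0)) | i. i < length [m, 0, 0]} =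
      {((0, 0), (1, 0)), ((1, 0), (2, 0)), ((2, 0), (0, 0::nat))}"
    by (force simp: less_Suc_eq)
  moreover have "{((i, 0::nat), (i, j)) | i j. i < length [m, 0, 0] \<and> 1 \<le> j \<and> j \<le> [m, 0, 0] ! i} =
      (\<lambda>j. ((0, 0), (0, j))) ` {1..m}"
    by (force simp: less_Suc_eq)
  ultimately show "parcs (cycle_pendants [m, 0, 0]) =
      symcl ({((0, 0), (1, 0)), ((1, 0), (2, 0)), ((2, 0), (0, 0))} \<union>
        (\<lambda>j. ((0, 0), (0, j))) ` {1..m})"
    by (simp only: cycle_pendants_def pair_pre_digraph.select_convs)
qed

lemma pendant_extension_triangle_pendants_ext:
  fixes t m :: nat
  assumes "m \<ge> 1"
  defines "cs \<equiv> [(0, 0), (1, 0), (2, 0), (0, 1)]"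
    and "f \<equiv> \<lambda>(i, j). if i = 3 then (0, 1) else (0, 0)"
  shows "pendant_extension paw_core cs f (triangle_pendants_ext t m)"
    and "pendant_counts f cs (triangle_pendants_ext t m) = [m - 1, 0, 0, t]"
    and "finite (pverts (triangle_pendants_ext t m))"
proof -
  let ?H = "triangle_pendants_ext t m"
  have further: "{(3, j) | j. 1 \<le> j \<and> j \<le> t} = Pair 3 ` {1..t}"
    "{((0, 1), (3, j)) | j. 1 \<le> j \<and> j \<le> t} = (\<lambda>j. ((0, 1), (3, j))) ` {1..t}"
    by auto
  have m: "{1..m} = insert 1 {2..m}"
    using assms(1) by auto
  have verts: "pverts ?H = set cs \<union> Pair 0 ` {2..m} \<union> Pair 3 ` {1..t}"
    unfolding triangle_pendants_ext_def Let_def cycle_pendants_triangle m further cs_def by auto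
  then show "finite (pverts ?H)" by simp
  have outer: "pverts ?H - set cs = Pair 0 ` {2..m} \<union> Pair 3 ` {1..t}"
    unfolding verts by (auto simp: cs_def)
  have "(\<lambda>v. (f v, v)) ` (pverts ?H - set cs) =
      (\<lambda>j. ((0, 0), (0, j))) ` {2..m} \<union> (\<lambda>j. ((0, 1), (3, j))) ` {1..t}"
    by (simp add: outer image_Un image_image f_def)
  moreover have "parcs ?H = symcl ({((0, 0), (1, 0)), ((1, 0), (2, 0)), ((2, 0), (0, 0))} \<union>
      (\<lambda>j. ((0, 0), (0, j))) ` {1..m} \<union> (\<lambda>j. ((0, 1), (3, j))) ` {1..t})"
    by (simp only: triangle_pendants_ext_def Let_def cycle_pendants_triangle further symcl_Un
        pair_pre_digraph.select_convs)
  ultimately have arcs: "parcs ?H =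
      symcl (core_arcs paw_core cs \<union> (\<lambda>v. (f v, v)) ` (pverts ?H - set cs))"
    unfolding m by (simp add: cs_def core_arcs_simps insert_commute)
  have "distinct cs" "set cs \<subseteq> pverts ?H" "f ` (pverts ?H - set cs) \<subseteq> set cs"
    unfolding outer by (auto simp: verts cs_def f_def)
  moreover have "paw_core \<subseteq> {..<length cs} \<times> {..<length cs}"
    using paw_core_subset by (simp add: cs_def numeral_eq_Suc)
  ultimately show "pendant_extension paw_core cs f ?H"
    using arcs by (simp only: pendant_extension_def)
  have "pendants f cs ?H (0, 0) = Pair 0 ` {2..m}" "pendants f cs ?H (0, 1) = Pair 3 ` {1..t}"
    "pendants f cs ?H (1, 0) = {}" "pendants f cs ?H (2, 0) = {}"
    unfolding pendants_def outer by (auto simp: f_def)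
  then show "pendant_counts f cs ?H = [m - 1, 0, 0, t]"
    by (simp add: pendant_counts_def cs_def card_image inj_on_def)
qed

lemma graph_iso_triangle_pendants_ext_iff:
  assumes "finite (pverts G)" "m \<ge> 1"
  shows "graph_iso G (triangle_pendants_ext t m) \<longleftrightarrow>
    (\<exists>cs f. pendant_extension paw_core cs f G \<and> pendant_counts f cs G = [m - 1, 0, 0, t])"
  using graph_iso_pendant_extension_iff[OF assms(1)
      pendant_extension_triangle_pendants_ext(1,3)[OF assms(2)]]
  by (simp only: pendant_extension_triangle_pendants_ext(2)[OF assms(2)])

lemma card_verts_triangle_pendants_ext:
  assumes "graph_iso G (triangle_pendants_ext t m)" "finite (pverts G)" "m \<ge> 1"
  shows "card (pverts G) = 3 + m + t"
proof -
  obtain cs f where ext: "pendant_extension paw_core cs f G"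
    and counts: "pendant_counts f cs G = [m - 1, 0, 0, t]"
    using assms graph_iso_triangle_pendants_ext_iff by blast
  have "length cs = 4"
    using arg_cong[OF counts, of length] by simp
  then show ?thesis
    using card_verts_pendant_extension[OF ext assms(2)] assms(3) by (simp add: counts)
qed

lemma triangle_pendants_ext_0: "triangle_pendants_ext 0 m = cycle_pendants [m, 0, 0]"
  by (simp add: triangle_pendants_ext_def cycle_pendants_def symcl_def Let_def)

section \<open>Distances and eccentricities\<close>

lemma (in pair_wf_digraph) ex_awalk_iff_relpow:
  assumes "u \<in> pverts G"
  shows "(\<exists>p. awalk u p v \<and> length p = k) \<longleftrightarrow> (u, v) \<in> parcs G ^^ k"
  using assms
proof (induction k arbitrary: u)
  case 0
  then show ?case by (auto simp: awalk_Nil_iff)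
next
  case (Suc k)
  have "(\<exists>p. awalk u p v \<and> length p = Suc k) \<longleftrightarrow>
      (\<exists>e p. awalk u (e # p) v \<and> length p = k)"
    by (metis length_Suc_conv)
  also have "\<dots> \<longleftrightarrow> (\<exists>w. (u, w) \<in> parcs G \<and> (\<exists>p. awalk w p v \<and> length p = k))"
    by (auto simp: split_paired_Ex awalk_Cons_iff)
  also have "\<dots> \<longleftrightarrow> (\<exists>w. (u, w) \<in> parcs G \<and> (w, v) \<in> parcs G ^^ k)"
    using Suc.IH wellformed' by blast
  also have "\<dots> \<longleftrightarrow> (u, v) \<in> parcs G ^^ Suc k"
    by (meson relpow_Suc_D2 relpow_Suc_I2)
  finally show ?case .
qed

locale connected_pair_graph = pair_graph +
  assumes conn: "Digraph_Component.connected (with_proj G)"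
begin

abbreviation adj :: "'a \<Rightarrow> 'a \<Rightarrow> bool" where
  "adj u v \<equiv> (u, v) \<in> parcs G"

lemma adj_sym: "adj u v \<Longrightarrow> adj v u"
  by (rule arcs_symmetric)

lemma relpow_adj_sym: "(u, v) \<in> parcs G ^^ k \<Longrightarrow> (v, u) \<in> parcs G ^^ k"
  by (induction k arbitrary: v) (auto simp del: relpow.simps(2) intro: relpow_Suc_I2 adj_sym
      elim!: relpow_Suc_E)

lemma ex_relpow_adj:
  assumes "u \<in> pverts G" "v \<in> pverts G"
  shows "\<exists>k. (u, v) \<in> parcs G ^^ k"
proof -
  have "strongly_connected (with_proj G)"
    using conn sym_arcs by (intro symmetric_connected_imp_strongly_connected) simp_all
  then have "u \<rightarrow>\<^sup>*\<^bsub>with_proj G\<^esub> v"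
    using assms by (auto simp: strongly_connected_def)
  then show ?thesis
    using ex_awalk_iff_relpow[OF assms(1)] by (auto simp: reachable_awalk)
qed

definition ndist :: "'a \<Rightarrow> 'a \<Rightarrow> nat" where
  "ndist u v = (LEAST k. (u, v) \<in> parcs G ^^ k)"

lemma relpow_ndist: "u \<in> pverts G \<Longrightarrow> v \<in> pverts G \<Longrightarrow> (u, v) \<in> parcs G ^^ ndist u v"
  unfolding ndist_def by (rule LeastI_ex) (rule ex_relpow_adj)

lemma ndist_le: "(u, v) \<in> parcs G ^^ k \<Longrightarrow> ndist u v \<le> k"
  unfolding ndist_def by (rule Least_le)

lemma awalk_cost_one: "awalk_cost (\<lambda>_. 1) p = real (length p)"
  by (induction p) auto

lemma gdist_eq_ndist:
  assumes "u \<in> pverts G" "v \<in> pverts G"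
  shows "gdist G u v = real (ndist u v)"
proof -
  obtain p where p: "awalk u p v" "length p = ndist u v"
    using relpow_ndist[OF assms] ex_awalk_iff_relpow[OF assms(1)] by blast
  have shortest: "ndist u v \<le> length q" if "awalk u q v" for q
    using that ex_awalk_iff_relpow[OF assms(1)] by (blast intro: ndist_le)
  have "\<mu> (\<lambda>_. 1) u v = ereal (real (ndist u v))"
    unfolding \<mu>_def
  proof (rule INF_eqI)
    show "ereal (real (ndist u v)) \<le> ereal (awalk_cost (\<lambda>_. 1) q)" if "q \<in> {p. awalk u p v}" for q
      using shortest[of q] that by (simp add: awalk_cost_one)
    show "y \<le> ereal (real (ndist u v))"
      if "\<And>q. q \<in> {p. awalk u p v} \<Longrightarrow> y \<le> ereal (awalk_cost (\<lambda>_. 1) q)" for y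
      using that[of p] p by (simp add: awalk_cost_one)
  qed
  then show ?thesis by (simp add: gdist_def)
qed

lemma ndist_triangle:
  assumes "u \<in> pverts G" "v \<in> pverts G" "w \<in> pverts G"
  shows "ndist u w \<le> ndist u v + ndist v w"
  using relpow_ndist assms by (intro ndist_le relpow_trans)

lemma ndist_sym:
  assumes "u \<in> pverts G" "v \<in> pverts G"
  shows "ndist u v = ndist v u"
  using assms by (simp add: antisym ndist_le[OF relpow_adj_sym[OF relpow_ndist]])

lemma ndist_adj: "adj u v \<Longrightarrow> ndist u v \<le> 1"
  by (rule ndist_le) simp

lemma ndist_eq_0_iff: "u \<in> pverts G \<Longrightarrow> v \<in> pverts G \<Longrightarrow> ndist u v = 0 \<longleftrightarrow> u = v"
  using relpow_ndist[of u v] ndist_le[of u v 0] by auto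

lemma ndist_le_2_iff:
  assumes "u \<in> pverts G" "v \<in> pverts G"
  shows "ndist u v \<le> 2 \<longleftrightarrow> v = u \<or> adj u v \<or> (\<exists>w. adj u w \<and> adj w v)"
proof
  assume "ndist u v \<le> 2"
  then consider "ndist u v = 0" | "ndist u v = 1" | "ndist u v = 2" by linarith
  then show "v = u \<or> adj u v \<or> (\<exists>w. adj u w \<and> adj w v)"
    using relpow_ndist[OF assms] by cases (auto simp: numeral_2_eq_2)
next
  assume "v = u \<or> adj u v \<or> (\<exists>w. adj u w \<and> adj w v)"
  then have "(u, v) \<in> parcs G ^^ 0 \<or> (u, v) \<in> parcs G ^^ 1 \<or> (u, v) \<in> parcs G ^^ 2"
    by (auto simp: numeral_2_eq_2)
  then show "ndist u v \<le> 2"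
    using ndist_le by fastforce
qed

definition necc :: "'a \<Rightarrow> nat" where
  "necc u = Max (ndist u ` pverts G)"

lemma necc_le_iff: "u \<in> pverts G \<Longrightarrow> necc u \<le> k \<longleftrightarrow> (\<forall>v\<in>pverts G. ndist u v \<le> k)"
  unfolding necc_def using pair_finite_verts by (subst Max_le_iff) auto

lemma ndist_le_necc: "u \<in> pverts G \<Longrightarrow> v \<in> pverts G \<Longrightarrow> ndist u v \<le> necc u"
  using necc_le_iff by blast

lemma ecc_eq_necc:
  assumes "u \<in> pverts G"
  shows "ecc G u = real (necc u)"
proof -
  have "{gdist G u v | v. v \<in> pverts G} = real ` ndist u ` pverts G"
    using assms by (simp add: Setcompr_eq_image image_image gdist_eq_ndist)
  then show ?thesis
    unfolding ecc_def necc_def using assms pair_finite_verts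
    by (subst mono_Max_commute[of real]) (auto simp: mono_def)
qed

lemma necc_le_ndist_add:
  assumes "u \<in> pverts G" "v \<in> pverts G"
  shows "necc v \<le> ndist v u + necc u"
  unfolding necc_le_iff[OF assms(2)]
  using ndist_triangle[OF assms(2,1)] ndist_le_necc[OF assms(1)] by fastforce

lemma necc_adj_le: "adj u v \<Longrightarrow> necc v \<le> Suc (necc u)"
  using necc_le_ndist_add[of u v] ndist_adj[of v u] adj_sym[of u v]
    in_arcsD1[of u v] in_arcsD2[of u v] by simp

lemma necc_le_double: "u \<in> pverts G \<Longrightarrow> v \<in> pverts G \<Longrightarrow> necc v \<le> 2 * necc u"
  using necc_le_ndist_add[of u v] ndist_le_necc[of u v] ndist_sym[of u v] by simp

definition central :: "'a \<Rightarrow> bool" where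
  "central u \<longleftrightarrow> necc u \<le> 2"

lemma central_iff:
  assumes "u \<in> pverts G"
  shows "central u \<longleftrightarrow> (\<forall>v\<in>pverts G. v = u \<or> adj u v \<or> (\<exists>w. adj u w \<and> adj w v))"
  using assms by (simp add: central_def necc_le_iff ndist_le_2_iff)

definition pendant_at :: "'a \<Rightarrow> 'a \<Rightarrow> bool" where
  "pendant_at u w \<longleftrightarrow> (\<forall>v. adj w v \<longleftrightarrow> v = u)"

lemma not_central_if_pendant_at:
  assumes "pendant_at u w" "v \<in> pverts G" "v \<noteq> u" "v \<noteq> w" "\<not> adj v u"
  shows "\<not> central v"
proof
  assume "central v"
  have w: "w \<in> pverts G" "\<And>z. adj z w \<Longrightarrow> z = u"
    using assms(1) adj_sym by (auto simp: pendant_at_def dest: in_arcsD1)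
  then have "w = v \<or> adj v w \<or> (\<exists>z. adj v z \<and> adj z w)"
    using \<open>central v\<close> assms(2) by (simp add: central_iff)
  then show False
    using w(2) assms(3-5) by auto
qed

definition far_arcs :: "'a rel" where
  "far_arcs = {(u, v). adj u v \<and> \<not> central u \<and> \<not> central v}"

lemma far_arcs_subset: "far_arcs \<subseteq> parcs G"
  by (auto simp: far_arcs_def)

lemma finite_far_arcs: "finite far_arcs"
  by (rule finite_subset[OF far_arcs_subset pair_finite_arcs])

lemma card_far_arcs_ge_4:
  assumes "(u, v) \<in> far_arcs" "(x, y) \<in> far_arcs" "{u, v} \<noteq> {x, y}"
  shows "card far_arcs \<ge> 4"
proof -
  have "u \<noteq> v" "x \<noteq> y"
    using assms by (auto simp: far_arcs_def dest: no_loops')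
  then have "card {(u, v), (v, u), (x, y), (y, x)} = 4"
    using assms(3) by (auto simp: card_insert_if)
  moreover have "{(u, v), (v, u), (x, y), (y, x)} \<subseteq> far_arcs"
    using assms(1,2) by (auto simp: far_arcs_def intro: adj_sym)
  ultimately show ?thesis
    using finite_far_arcs by (metis card_mono)
qed

lemma card_far_arcs_ge_4_pendants:
  assumes w: "pendant_at u w" and w': "pendant_at u' w'" and u: "u \<noteq> u'" "\<not> adj u u'"
  shows "card far_arcs \<ge> 4"
proof (rule card_far_arcs_ge_4)
  have arcs: "adj w u" "adj w' u'" "\<not> adj u' u"
    using w w' u(2) adj_sym by (auto simp: pendant_at_def)
  have ne: "w \<noteq> w'" "u \<noteq> w'" "w \<noteq> u'" "\<not> adj w u'" "\<not> adj w' u"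
    using w w' u arcs by (auto simp: pendant_at_def)
  have verts: "w \<in> pverts G" "u \<in> pverts G" "w' \<in> pverts G" "u' \<in> pverts G"
    using arcs by (auto dest: in_arcsD1 in_arcsD2)
  show "(w, u) \<in> far_arcs"
    using arcs ne u verts by (simp add: far_arcs_def not_central_if_pendant_at[OF w'])
  show "(w', u') \<in> far_arcs"
    using arcs ne u verts by (simp add: far_arcs_def not_central_if_pendant_at[OF w])
  show "{w, u} \<noteq> {w', u'}"
    using ne u by (auto simp: doubleton_eq_iff)
qed

section \<open>Central vertices of pendant extensions\<close>

lemma adj_iff_core_arcs:
  assumes "pendant_extension E cs f G" "u \<in> set cs" "v \<in> set cs"
  shows "adj u v \<longleftrightarrow> (u, v) \<in> core_arcs E cs \<or> (v, u) \<in> core_arcs E cs"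
  using assms by (auto simp: pendant_extension_def symcl_iff)

lemma pendant_at_support:
  assumes ext: "pendant_extension E cs f G" and w: "w \<in> pverts G - set cs"
  shows "pendant_at (f w) w"
proof -
  have "(w, v) \<notin> core_arcs E cs" "(v, w) \<notin> core_arcs E cs" for v
    using ext w core_arcs_subset[of E cs] by (auto simp: pendant_extension_def)
  then show ?thesis
    using ext w by (auto simp: pendant_extension_def pendant_at_def symcl_iff)
qed

lemma not_central_if_support:
  assumes ext: "pendant_extension E cs f G" and v: "v \<in> f ` (pverts G - set cs)"
    and u: "u \<in> set cs" "u \<noteq> v" "\<not> adj u v"
  shows "\<not> central u"
proof -
  obtain w where "w \<in> pverts G - set cs" "v = f w"
    using v by blast
  then show ?thesis
    using pendant_at_support[OF ext, of w] u ext
    by (intro not_central_if_pendant_at[of v w]) (auto simp: pendant_extension_def)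
qed

lemma card_far_arcs_ge_4_supports:
  assumes ext: "pendant_extension E cs f G"
    and "u \<in> f ` (pverts G - set cs)" "v \<in> f ` (pverts G - set cs)" "u \<noteq> v" "\<not> adj u v"
  shows "card far_arcs \<ge> 4"
  using assms pendant_at_support[OF ext] card_far_arcs_ge_4_pendants by blast

lemma card_far_arcs_ge_4_pentagon:
  assumes ext: "pendant_extension (cycle_core 5) [v0, v1, v2, v3, v4] f G"
    and v0: "v0 \<in> f ` (pverts G - set [v0, v1, v2, v3, v4])"
    and v1: "v1 \<in> f ` (pverts G - set [v0, v1, v2, v3, v4])"
  shows "card far_arcs \<ge> 4"
proof -
  note adj_iff = adj_iff_core_arcs[OF ext, unfolded core_arcs_simps]
  have dist: "distinct [v0, v1, v2, v3, v4]"
    using ext by (simp add: pendant_extension_def)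
  have "\<not> central v2" "\<not> central v3"
    using dist by (intro not_central_if_support[OF ext v0]; auto simp: adj_iff)+
  moreover have "\<not> central v4"
    using dist by (intro not_central_if_support[OF ext v1]) (auto simp: adj_iff)
  ultimately have "(v2, v3) \<in> far_arcs" "(v3, v4) \<in> far_arcs"
    by (simp_all add: far_arcs_def adj_iff)
  then show ?thesis
    using dist by (intro card_far_arcs_ge_4[of v2 v3 v3 v4]) (auto simp: doubleton_eq_iff)
qed

lemma central_coreI:
  assumes ext: "pendant_extension E cs f G" and supp: "f ` (pverts G - set cs) \<subseteq> S"
    and u: "u \<in> set cs"
    and core: "\<And>v. v \<in> set cs \<Longrightarrow> v = u \<or> adj u v \<or> (\<exists>w. adj u w \<and> adj w v)"
    and supports: "\<And>v. v \<in> S \<Longrightarrow> v = u \<or> adj u v"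
  shows "central u"
proof -
  have "v = u \<or> adj u v \<or> (\<exists>w. adj u w \<and> adj w v)" if v: "v \<in> pverts G" for v
  proof (cases "v \<in> set cs")
    case False
    then have "adj (f v) v"
      using pendant_at_support[OF ext, of v] v adj_sym by (auto simp: pendant_at_def)
    then show ?thesis
      using supports[of "f v"] supp v False by auto
  qed (rule core)
  then show ?thesis
    using u ext central_iff[of u] by (auto simp: pendant_extension_def)
qed

section \<open>Spanning trees and fundamental cycles\<close>

definition spanning_connected :: "'a rel \<Rightarrow> bool" where
  "spanning_connected T \<longleftrightarrow> T \<subseteq> parcs G \<and> sym T \<and> (\<forall>u\<in>pverts G. \<forall>v\<in>pverts G. (u, v) \<in> T\<^sup>*)"

lemma spanning_connected_path:
  assumes T: "spanning_connected T" and uv: "u \<in> pverts G" "v \<in> pverts G"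
  obtains q where "awalk u q v" "set q \<subseteq> T" "distinct (pawalk_verts u q)"
proof -
  have sub: "T \<subseteq> parcs G" using T by (simp add: spanning_connected_def)
  interpret H: pair_wf_digraph "\<lparr>pverts = pverts G, parcs = T\<rparr>"
    using sub wellformed' by unfold_locales auto
  have "(u, v) \<in> T\<^sup>*"
    using T uv by (simp add: spanning_connected_def)
  then obtain k where "(u, v) \<in> T ^^ k"
    using rtrancl_imp_relpow by blast
  then obtain q where "H.awalk u q v"
    using H.ex_awalk_iff_relpow[of u v k] uv by auto
  then have "H.apath u (H.awalk_to_apath q) v"
    by (rule H.apath_awalk_to_apath)
  then have "awalk u (H.awalk_to_apath q) v" "set (H.awalk_to_apath q) \<subseteq> T"
    "distinct (pawalk_verts u (H.awalk_to_apath q))"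
    using uv sub by (auto simp: H.apath_def H.awalk_def awalk_def)
  then show thesis by (rule that)
qed

lemma fundamental_cycle:
  assumes T: "spanning_connected T" and uv: "adj u v" "(u, v) \<notin> T"
  shows "\<exists>C\<in>cycles G. {u, v} \<in> C \<and> (\<forall>x y. {x, y} \<in> C \<longrightarrow> {x, y} = {u, v} \<or> (x, y) \<in> T)"
proof -
  have V: "u \<in> pverts G" "v \<in> pverts G" and "u \<noteq> v"
    using uv(1) by (auto dest: in_arcsD1 in_arcsD2 no_loops')
  have "sym T" using T by (simp add: spanning_connected_def)
  obtain q where q: "awalk v q u" "set q \<subseteq> T" "distinct (pawalk_verts v q)"
    using spanning_connected_path[OF T V(2,1)] .
  have "cycle ((u, v) # q)"
    unfolding cycle_def using q uv(1) by (intro exI[of _ u]) (simp add: awalk_Cons_iff)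
  moreover have "length ((u, v) # q) \<ge> 3"
  proof -
    have "q \<noteq> []" using q(1) \<open>u \<noteq> v\<close> by (auto simp: awalk_Nil_iff)
    moreover have "q \<noteq> [e]" for e
      using q(1,2) uv(2) symD[OF \<open>sym T\<close>, of v u]
      by (cases e) (auto simp: awalk_Cons_iff awalk_Nil_iff)
    ultimately show ?thesis by (cases q; cases "tl q") auto
  qed
  ultimately have "(\<lambda>(u, v). {u, v}) ` set ((u, v) # q) \<in> cycles G"
    unfolding cycles_def by blast
  moreover have "{x, y} = {u, v} \<or> (x, y) \<in> T"
    if "{x, y} \<in> (\<lambda>(u, v). {u, v}) ` set ((u, v) # q)" for x y
    using that subsetD[OF q(2)] symD[OF \<open>sym T\<close>] by (auto simp: doubleton_eq_iff)
  ultimately show ?thesis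
    by (intro bexI[of _ "(\<lambda>(u, v). {u, v}) ` set ((u, v) # q)"]) auto
qed

definition tree_arcs :: "'a \<Rightarrow> ('a \<Rightarrow> 'a) \<Rightarrow> 'a rel" where
  "tree_arcs r p = symcl ((\<lambda>v. (p v, v)) ` (pverts G - {r}))"

definition bfs_parent :: "'a \<Rightarrow> ('a \<Rightarrow> 'a) \<Rightarrow> bool" where
  "bfs_parent r p \<longleftrightarrow> (\<forall>v\<in>pverts G - {r}. adj (p v) v \<and> ndist r v = Suc (ndist r (p v)))"

lemma ex_bfs_parent:
  assumes r: "r \<in> pverts G"
  shows "\<exists>p. bfs_parent r p"
proof -
  have "\<exists>w. adj w v \<and> ndist r v = Suc (ndist r w)" if v: "v \<in> pverts G" "v \<noteq> r" for v
  proof -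
    obtain k where k: "ndist r v = Suc k"
      using ndist_eq_0_iff[OF r v(1)] v(2) by (cases "ndist r v") auto
    then obtain w where w: "(r, w) \<in> parcs G ^^ k" "adj w v"
      using relpow_ndist[OF r v(1)] by auto
    then have "ndist r v \<le> ndist r w + 1"
      using ndist_triangle[OF r, of w v] ndist_adj[of w v] by (fastforce dest: in_arcsD1 in_arcsD2)
    then show ?thesis
      using k w ndist_le[OF w(1)] by (intro exI[of _ w]) simp
  qed
  then show ?thesis
    unfolding bfs_parent_def by (intro bchoice) auto
qed

lemma spanning_connected_tree_arcs:
  assumes p: "bfs_parent r p"
  shows "spanning_connected (tree_arcs r p)"
proof -
  let ?T = "tree_arcs r p"
  have "(v, r) \<in> ?T\<^sup>*" if "v \<in> pverts G" for v
    using that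
  proof (induction "ndist r v" arbitrary: v rule: less_induct)
    case less
    show ?case
    proof (cases "v = r")
      case False
      then have "(v, p v) \<in> ?T"
        using less.prems by (simp add: tree_arcs_def symcl_iff)
      moreover have "(p v, r) \<in> ?T\<^sup>*"
        using False less p by (intro less.hyps) (auto simp: bfs_parent_def dest: in_arcsD1)
      ultimately show ?thesis by (rule converse_rtrancl_into_rtrancl)
    qed simp
  qed
  moreover have "sym ?T"
    by (auto simp: sym_def tree_arcs_def symcl_iff)
  moreover have "?T \<subseteq> parcs G"
    using p by (auto simp: bfs_parent_def tree_arcs_def symcl_def intro: adj_sym)
  ultimately show ?thesis
    unfolding spanning_connected_def by (meson rtrancl_trans sym_rtrancl symD)
qed

lemma card_tree_arcs_le:
  assumes "r \<in> pverts G"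
  shows "card (tree_arcs r p) \<le> 2 * (card (pverts G) - 1)"
proof -
  let ?A = "(\<lambda>v. (p v, v)) ` (pverts G - {r})"
  have "card (tree_arcs r p) \<le> card ?A + card ((\<lambda>(a, b). (b, a)) ` ?A)"
    unfolding tree_arcs_def symcl_def by (rule card_Un_le)
  also have "\<dots> \<le> card (pverts G - {r}) + card (pverts G - {r})"
    unfolding image_image using pair_finite_verts by (intro add_mono card_image_le) auto
  finally show ?thesis
    using assms by simp
qed

end

locale at_most_unicyclic_graph = connected_pair_graph +
  assumes unique_cycle: "C \<in> cycles G \<Longrightarrow> D \<in> cycles G \<Longrightarrow> C = D"
begin

lemma arcs_spanning_cases:
  assumes T: "spanning_connected T"
  obtains (tree) "parcs G = T"
    | (extra) x y where "adj x y" "(x, y) \<notin> T" "parcs G = T \<union> {(x, y), (y, x)}"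
proof (cases "parcs G = T")
  case False
  have sub: "T \<subseteq> parcs G" using T by (simp add: spanning_connected_def)
  obtain x y where xy: "adj x y" "(x, y) \<notin> T" using False sub by auto
  obtain C where C: "C \<in> cycles G" "{x, y} \<in> C"
    "\<forall>u v. {u, v} \<in> C \<longrightarrow> {u, v} = {x, y} \<or> (u, v) \<in> T"
    using fundamental_cycle[OF T xy] by blast
  have "{u, v} = {x, y}" if uv: "adj u v" "(u, v) \<notin> T" for u v
  proof -
    obtain D where "D \<in> cycles G" "{u, v} \<in> D"
      using fundamental_cycle[OF T uv] by blast
    then have "{u, v} \<in> C"
      using unique_cycle[OF C(1)] by simp
    then show ?thesis
      using C(3) uv(2) by metis
  qed
  then have "parcs G \<subseteq> T \<union> {(x, y), (y, x)}"
    by (auto simp: doubleton_eq_iff)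
  then have "parcs G = T \<union> {(x, y), (y, x)}"
    using sub xy(1) adj_sym by blast
  then show ?thesis using extra xy by blast
qed (rule tree)

lemma card_arcs_le: "card (parcs G) \<le> 2 * card (pverts G)"
proof (cases "pverts G = {}")
  case True
  then have "parcs G = {}" using in_arcsD1 by auto
  then show ?thesis by simp
next
  case False
  then obtain r where r: "r \<in> pverts G" by blast
  then obtain p where p: "bfs_parent r p" using ex_bfs_parent by blast
  have card_tree: "card (tree_arcs r p) + 2 \<le> 2 * card (pverts G)"
    using card_tree_arcs_le[OF r, of p] r pair_finite_verts card_gt_0_iff[of "pverts G"] by auto
  show ?thesis
    using spanning_connected_tree_arcs[OF p]
  proof (cases rule: arcs_spanning_cases)
    case tree
    then show ?thesis using card_tree by simp
  next
    case (extra x y)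
    have "card (parcs G) \<le> card (tree_arcs r p) + card {(x, y), (y, x)}"
      unfolding extra(3) by (rule card_Un_le)
    also have "card {(x, y), (y, x)} \<le> 2"
      using card_insert_le_m1[of 2 "{(y, x)}" "(x, y)"] by simp
    finally show ?thesis using card_tree by simp
  qed
qed

end

section \<open>Edge contributions\<close>

lemma abc_f_commute: "abc_f x y = abc_f y x"
  by (simp add: abc_f_def algebra_simps)

lemma abc_f_2: "y > 0 \<Longrightarrow> abc_f 2 y = sqrt (1 / 2)"
  by (simp add: abc_f_def)

lemma abc_f_3_3: "abc_f 3 3 = 2 / 3"
proof -
  have "abc_f 3 3 = sqrt ((2 / 3)\<^sup>2)" by (simp add: abc_f_def power2_eq_square)
  then show ?thesis by (simp only: real_sqrt_abs)
qed

lemma abc_f_3_3_less: "abc_f 3 3 < sqrt (1 / 2)"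
  unfolding abc_f_3_3 by (rule real_less_rsqrt) (simp add: power2_eq_square)

lemma abc_f_le_sqrt_half:
  assumes "x \<ge> 2" "y \<ge> 2"
  shows "abc_f x y \<le> sqrt (1 / 2)"
proof -
  have "0 \<le> (x - 2) * (y - 2)" using assms by simp
  then have "(x + y - 2) / (x * y) \<le> 1 / 2"
    using assms by (simp add: field_simps)
  then show ?thesis unfolding abc_f_def by (rule real_sqrt_le_mono)
qed

lemma abc_f_le_3_3:
  assumes "x \<ge> 3" "y \<ge> 3"
  shows "abc_f x y \<le> abc_f 3 3"
proof -
  \<comment> \<open>Clearing denominators and completing the product, the claim becomes
    \<open>9 \<le> (4 * x - 9) * (4 * y - 9)\<close>.\<close>
  have "3 * 3 \<le> (4 * x - 9) * (4 * y - 9)"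
    using assms by (intro mult_mono) auto
  then have "(x + y - 2) / (x * y) \<le> (3 + 3 - 2) / (3 * 3)"
    using assms by (simp add: field_simps)
  then show ?thesis unfolding abc_f_def by (rule real_sqrt_le_mono)
qed

lemma abc_f_near_le_sqrt_half:
  fixes x y :: nat
  assumes "x \<le> Suc y" "y \<le> Suc x"
  shows "abc_f x y \<le> sqrt (1 / 2)"
proof -
  \<comment> \<open>This includes the junk value \<open>abc_f 0 j = 0\<close>.\<close>
  have small: "abc_f i j \<le> sqrt (1 / 2)" if "i \<le> 1" "j \<le> 2" for i j :: nat
  proof -
    have "i = 0 \<or> i = 1" "j = 0 \<or> j = 1 \<or> j = 2" using that by auto
    then show ?thesis by (auto simp: abc_f_def)
  qed
  consider "x \<ge> 2" "y \<ge> 2" | "x \<le> 1" "y \<le> 2" | "y \<le> 1" "x \<le> 2"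
    using assms by linarith
  then show ?thesis
    by cases (use abc_f_le_sqrt_half small[of x y] small[of y x] abc_f_commute[of x y] in auto)
qed

definition unicyclic_bound :: "nat \<Rightarrow> real" where
  "unicyclic_bound n = (real n - 1) * sqrt (1 / 2) + abc_f 3 3"

context connected_pair_graph
begin

lemma ABC3_le:
  "2 * ABC3 G \<le> card (parcs G) * sqrt (1 / 2) - card far_arcs * (sqrt (1 / 2) - abc_f 3 3)"
proof -
  let ?f = "\<lambda>(u, v). abc_f (ecc G u) (ecc G v)"
  have "2 * ABC3 G = sum ?f (parcs G - far_arcs) + sum ?f far_arcs"
    by (simp add: ABC3_def sum.subset_diff[OF far_arcs_subset pair_finite_arcs])
  also have "sum ?f (parcs G - far_arcs) \<le> card (parcs G - far_arcs) * sqrt (1 / 2)"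
  proof (rule sum_bounded_above, clarify)
    fix u v assume "adj u v"
    then show "abc_f (ecc G u) (ecc G v) \<le> sqrt (1 / 2)"
      using necc_adj_le[of u v] necc_adj_le[of v u] adj_sym[of u v]
      by (simp add: ecc_eq_necc wellformed' abc_f_near_le_sqrt_half)
  qed
  also have "sum ?f far_arcs \<le> card far_arcs * abc_f 3 3"
  proof (rule sum_bounded_above, clarify)
    fix u v assume "(u, v) \<in> far_arcs"
    then show "abc_f (ecc G u) (ecc G v) \<le> abc_f 3 3"
      by (auto simp: far_arcs_def ecc_eq_necc wellformed' central_def intro!: abc_f_le_3_3)
  qed
  also have "real (card (parcs G - far_arcs)) =
      real (card (parcs G)) - real (card far_arcs)"
    using card_mono[OF pair_finite_arcs far_arcs_subset]
    by (simp add: card_Diff_subset[OF finite_far_arcs far_arcs_subset])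
  finally show ?thesis by (simp add: algebra_simps)
qed

lemma ABC3_less_if_few_arcs:
  assumes "card (parcs G) + 2 \<le> 2 * card (pverts G)"
  shows "ABC3 G < unicyclic_bound (card (pverts G))"
proof -
  let ?s = "sqrt (1 / 2)"
  have "real (card (parcs G)) * ?s \<le> (2 * real (card (pverts G)) - 2) * ?s"
    using assms by (intro mult_right_mono) auto
  moreover have "0 \<le> card far_arcs * (?s - abc_f 3 3)"
    using abc_f_3_3_less by simp
  ultimately have "2 * ABC3 G \<le> (2 * real (card (pverts G)) - 2) * ?s"
    using ABC3_le by linarith
  then show ?thesis
    by (simp add: unicyclic_bound_def abc_f_3_3 algebra_simps)
qed

lemma ABC3_less_if_far_arcs:
  assumes "card (parcs G) \<le> 2 * card (pverts G)" "card far_arcs \<ge> 4"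
  shows "ABC3 G < unicyclic_bound (card (pverts G))"
proof -
  let ?s = "sqrt (1 / 2)"
  have "real (card (parcs G)) * ?s \<le> 2 * real (card (pverts G)) * ?s"
    using assms(1) by (intro mult_right_mono) auto
  moreover have "4 * (?s - abc_f 3 3) \<le> card far_arcs * (?s - abc_f 3 3)"
    using assms(2) abc_f_3_3_less by (intro mult_right_mono) auto
  ultimately have "2 * ABC3 G \<le> 2 * real (card (pverts G)) * ?s - 4 * (?s - abc_f 3 3)"
    using ABC3_le by linarith
  then show ?thesis
    using abc_f_3_3_less by (simp add: unicyclic_bound_def algebra_simps)
qed

lemma necc_eq_2_if_central:
  assumes "central u" "u \<in> pverts G" "\<not> central v" "v \<in> pverts G"
  shows "necc u = 2"
  using assms necc_le_double[of u v] by (simp add: central_def)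

lemma necc_eq_3_if_adj_central:
  assumes "adj u v" "central u" "\<not> central v"
  shows "necc v = 3"
  using assms necc_adj_le[of u v] by (simp add: central_def)

lemma ABC3_eq_if_one_far_edge:
  assumes card: "card (parcs G) = 2 * card (pverts G)" and far: "far_arcs = {(p, q), (q, p)}"
    and ecc: "necc p = 3" "necc q = 3"
  shows "ABC3 G = unicyclic_bound (card (pverts G))"
proof -
  let ?f = "\<lambda>(u, v). abc_f (ecc G u) (ecc G v)"
  have pq: "adj p q" "\<not> central p"
    using far by (auto simp: far_arcs_def)
  then have "p \<noteq> q" and V: "p \<in> pverts G" "q \<in> pverts G"
    by (auto dest: no_loops' in_arcsD1 in_arcsD2)
  have near: "?f e = sqrt (1 / 2)" if "e \<in> parcs G - far_arcs" for e
  proof -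
    obtain u v where e: "e = (u, v)" by (cases e)
    then have "central u \<or> central v" and "u \<in> pverts G" "v \<in> pverts G"
      using that by (auto simp: far_arcs_def dest: in_arcsD1 in_arcsD2)
    moreover from this have "necc u > 0" "necc v > 0"
      using necc_le_double[of u p] necc_le_double[of v p] V pq by (auto simp: central_def)
    ultimately show ?thesis
      using e necc_eq_2_if_central pq V
      by (auto simp: ecc_eq_necc abc_f_2 abc_f_commute[of _ 2])
  qed
  have "card (parcs G - far_arcs) = 2 * card (pverts G) - 2"
    using card_Diff_subset[OF finite_far_arcs far_arcs_subset] card far \<open>p \<noteq> q\<close> by simp
  moreover have "card (pverts G) \<ge> 1"
    using V pair_finite_verts by (auto simp: Suc_le_eq card_gt_0_iff)
  ultimately have "sum ?f (parcs G - far_arcs) = (2 * real (card (pverts G)) - 2) * sqrt (1 / 2)"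
    using near by (simp add: of_nat_diff)
  moreover have "sum ?f far_arcs = 2 * abc_f 3 3"
    using \<open>p \<noteq> q\<close> V ecc by (simp add: far ecc_eq_necc)
  moreover have "2 * ABC3 G = sum ?f (parcs G - far_arcs) + sum ?f far_arcs"
    by (simp add: ABC3_def sum.subset_diff[OF far_arcs_subset pair_finite_arcs])
  ultimately show ?thesis
    by (simp add: unicyclic_bound_def algebra_simps)
qed

section \<open>The extremal graphs\<close>

lemma ABC3_eq_if_pendant_extension:
  assumes ext: "pendant_extension E cs f G" and supp: "f ` (pverts G - set cs) \<subseteq> S"
    and E: "asym E" "card E = length cs"
    and p: "p \<in> set cs" "\<not> central p" "adj p' p" "central p'"
    and q: "q \<in> set cs" "\<not> central q" "adj q' q" "central q'"
    and "adj p q" and central: "\<And>v. v \<in> set cs - {p, q} \<Longrightarrow> central v"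
    and supports: "\<And>v. v \<in> S \<Longrightarrow> central v"
  shows "ABC3 G = unicyclic_bound (card (pverts G))"
proof (rule ABC3_eq_if_one_far_edge)
  have cs: "distinct cs" "set cs \<subseteq> pverts G"
    using ext by (simp_all add: pendant_extension_def)
  then have "card E + card (pverts G - set cs) = card (pverts G)"
    using E(2) card_mono[OF pair_finite_verts cs(2)] by (simp add: card_Diff_subset distinct_card)
  then show "card (parcs G) = 2 * card (pverts G)"
    using card_arcs_pendant_extension[OF ext pair_finite_verts E(1)] by simp
  have core: "v \<in> set cs" if "adj u v" "\<not> central u" for u v
  proof (rule ccontr)
    assume "v \<notin> set cs"
    moreover have "v \<in> pverts G"
      using that(1) by (rule in_arcsD2)
    ultimately have "u = f v" "central (f v)"
      using pendant_at_support[OF ext, of v] supports[of u] supp adj_sym[OF that(1)]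
      by (auto simp: pendant_at_def)
    then show False using that(2) by simp
  qed
  have "{u, v} = {p, q}" if "adj u v" "\<not> central u" "\<not> central v" for u v
    using core[of u v] core[of v u] that central[of u] central[of v] adj_sym[of u v] no_loops'[of u]
    by auto
  then show "far_arcs = {(p, q), (q, p)}"
    using p(2) q(2) \<open>adj p q\<close> adj_sym[of p q] by (auto simp: far_arcs_def doubleton_eq_iff)
qed (use p q necc_eq_3_if_adj_central in auto)

lemma ABC3_eq_pentagon:
  assumes iso: "graph_iso G (cycle_pendants [m, 0, 0, 0, 0])" and "m \<ge> 1"
  shows "ABC3 G = unicyclic_bound (card (pverts G))"
proof -
  obtain cs f where "pendant_extension (cycle_core 5) cs f G"
    "pendant_counts f cs G = [m, 0, 0, 0, 0]"
    using iso by (auto simp: graph_iso_cycle_pendants_iff[OF pair_finite_verts] numeral_eq_Suc)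
  moreover from this obtain v0 v1 v2 v3 v4 where "cs = [v0, v1, v2, v3, v4]"
    by (auto simp: pendant_counts_def Cons_eq_map_conv)
  ultimately have ext: "pendant_extension (cycle_core 5) [v0, v1, v2, v3, v4] f G"
    and "v0 \<in> f ` (pverts G - set [v0, v1, v2, v3, v4])"
    and supp: "f ` (pverts G - set [v0, v1, v2, v3, v4]) \<subseteq> {v0}"
    using image_supports[of _ cs f G] pair_finite_verts \<open>m \<ge> 1\<close> by auto
  note adj_iff = adj_iff_core_arcs[OF ext, unfolded core_arcs_simps]
  have dist: "distinct [v0, v1, v2, v3, v4]"
    using ext by (simp add: pendant_extension_def)
  have adj: "adj v0 v1" "adj v1 v0" "adj v1 v2" "adj v2 v3" "adj v3 v2" "adj v4 v3"
    "adj v4 v0" "adj v0 v4"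
    by (simp_all add: adj_iff)
  have "\<not> central v2" "\<not> central v3"
    using dist by (intro not_central_if_support[OF ext \<open>v0 \<in> _\<close>]; auto simp: adj_iff)+
  moreover have "central v0" "central v1" "central v4"
    using adj by (auto intro!: central_coreI[OF ext supp])
  ultimately show ?thesis
    using adj dist
    by (intro ABC3_eq_if_pendant_extension[OF ext supp asym_cycle_core, of v2 v1 v3 v4])
      (auto simp: card_cycle_core)
qed

lemma ABC3_eq_quadrangle:
  assumes iso: "graph_iso G (cycle_pendants [n1, n2, 0, 0])" and "n1 \<ge> 1" "n2 \<ge> 1"
  shows "ABC3 G = unicyclic_bound (card (pverts G))"
proof -
  obtain cs f where "pendant_extension (cycle_core 4) cs f G"
    "pendant_counts f cs G = [n1, n2, 0, 0]"
    using iso by (auto simp: graph_iso_cycle_pendants_iff[OF pair_finite_verts] numeral_eq_Suc)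
  moreover from this obtain v0 v1 v2 v3 where "cs = [v0, v1, v2, v3]"
    by (auto simp: pendant_counts_def Cons_eq_map_conv)
  ultimately have ext: "pendant_extension (cycle_core 4) [v0, v1, v2, v3] f G"
    and "v0 \<in> f ` (pverts G - set [v0, v1, v2, v3])" "v1 \<in> f ` (pverts G - set [v0, v1, v2, v3])"
    and supp: "f ` (pverts G - set [v0, v1, v2, v3]) \<subseteq> {v0, v1}"
    using image_supports[of _ cs f G] pair_finite_verts assms(2,3) by auto
  note adj_iff = adj_iff_core_arcs[OF ext, unfolded core_arcs_simps]
  have dist: "distinct [v0, v1, v2, v3]"
    using ext by (simp add: pendant_extension_def)
  have adj: "adj v0 v1" "adj v1 v0" "adj v1 v2" "adj v2 v3" "adj v0 v3"
    by (simp_all add: adj_iff)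
  have "\<not> central v2"
    using dist by (intro not_central_if_support[OF ext \<open>v0 \<in> _\<close>]) (auto simp: adj_iff)
  moreover have "\<not> central v3"
    using dist by (intro not_central_if_support[OF ext \<open>v1 \<in> _\<close>]) (auto simp: adj_iff)
  moreover have "central v0" "central v1"
    using adj by (auto intro!: central_coreI[OF ext supp])
  ultimately show ?thesis
    using adj dist
    by (intro ABC3_eq_if_pendant_extension[OF ext supp asym_cycle_core, of v2 v1 v3 v0])
      (auto simp: card_cycle_core)
qed

lemma ABC3_eq_triangle_ext:
  assumes iso: "graph_iso G (triangle_pendants_ext t m)" and "m \<ge> 1" "t \<ge> 1"
  shows "ABC3 G = unicyclic_bound (card (pverts G))"
proof -
  obtain cs f where "pendant_extension paw_core cs f G" "pendant_counts f cs G = [m - 1, 0, 0, t]"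
    using iso by (auto simp: graph_iso_triangle_pendants_ext_iff[OF pair_finite_verts \<open>m \<ge> 1\<close>])
  moreover from this obtain v0 v1 v2 v3 where "cs = [v0, v1, v2, v3]"
    by (auto simp: pendant_counts_def Cons_eq_map_conv)
  ultimately have ext: "pendant_extension paw_core [v0, v1, v2, v3] f G"
    and "v3 \<in> f ` (pverts G - set [v0, v1, v2, v3])"
    and supp: "f ` (pverts G - set [v0, v1, v2, v3]) \<subseteq> {v0, v3}"
    using image_supports[of _ cs f G] pair_finite_verts assms(3) by auto
  note adj_iff = adj_iff_core_arcs[OF ext, unfolded core_arcs_simps]
  have dist: "distinct [v0, v1, v2, v3]"
    using ext by (simp add: pendant_extension_def)
  have adj: "adj v0 v1" "adj v0 v2" "adj v1 v2" "adj v0 v3" "adj v3 v0"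
    by (simp_all add: adj_iff)
  have "\<not> central v1" "\<not> central v2"
    using dist by (intro not_central_if_support[OF ext \<open>v3 \<in> _\<close>]; auto simp: adj_iff)+
  moreover have "central v0" "central v3"
    using adj by (auto intro!: central_coreI[OF ext supp])
  ultimately show ?thesis
    using adj dist
    by (intro ABC3_eq_if_pendant_extension[OF ext supp asym_paw_core, of v1 v0 v2 v0])
      (auto simp: card_paw_core)
qed

end

section \<open>The listed graphs\<close>

definition listed_graph :: "'a pair_pre_digraph \<Rightarrow> bool" where
  "listed_graph G \<longleftrightarrow>
     (\<exists>n1 n2 n3. graph_iso G (cycle_pendants [n1, n2, n3])) \<or>
     (\<exists>n1 n2. graph_iso G (cycle_pendants [n1, n2, 0, 0])) \<or>
     (\<exists>m. graph_iso G (cycle_pendants [m, 0, 0, 0, 0])) \<or>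
     (\<exists>t m. m \<ge> 1 \<and> graph_iso G (triangle_pendants_ext t m))"

lemma pendants_empty:
  assumes "f ` (pverts G - set cs) \<subseteq> S" "v \<notin> S"
  shows "pendants f cs G v = {}"
  using assms by (auto simp: pendants_def)

lemma listed_graph_triangle:
  assumes "finite (pverts G)" "pendant_extension (cycle_core 3) [v0, v1, v2] f G"
  shows "listed_graph G"
proof -
  have "graph_iso G (cycle_pendants (pendant_counts f [v0, v1, v2] G))"
    using assms by (auto simp: graph_iso_cycle_pendants_iff numeral_3_eq_3)
  then show ?thesis
    unfolding listed_graph_def pendant_counts_def by auto
qed

lemma listed_graph_quadrangle:
  assumes "finite (pverts G)" and ext: "pendant_extension (cycle_core 4) [v0, v1, v2, v3] f G"
    and supp: "f ` (pverts G - {v0, v1, v2, v3}) \<subseteq> {v0, v1}"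
  shows "listed_graph G"
proof -
  have "v2 \<notin> {v0, v1}" "v3 \<notin> {v0, v1}"
    using ext by (auto simp: pendant_extension_def)
  then have "\<exists>n1 n2. pendant_counts f [v0, v1, v2, v3] G = [n1, n2, 0, 0]"
    using supp by (simp add: pendant_counts_def pendants_empty)
  moreover have "graph_iso G (cycle_pendants (pendant_counts f [v0, v1, v2, v3] G))"
    using assms by (auto simp: graph_iso_cycle_pendants_iff numeral_eq_Suc)
  ultimately show ?thesis
    unfolding listed_graph_def by metis
qed

lemma listed_graph_pentagon:
  assumes "finite (pverts G)" and ext: "pendant_extension (cycle_core 5) [v0, v1, v2, v3, v4] f G"
    and supp: "f ` (pverts G - {v0, v1, v2, v3, v4}) \<subseteq> {v0}"
  shows "listed_graph G"
proof -
  have "v1 \<notin> {v0}" "v2 \<notin> {v0}" "v3 \<notin> {v0}" "v4 \<notin> {v0}"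
    using ext by (auto simp: pendant_extension_def)
  then have "\<exists>m. pendant_counts f [v0, v1, v2, v3, v4] G = [m, 0, 0, 0, 0]"
    using supp by (simp add: pendant_counts_def pendants_empty)
  moreover have "graph_iso G (cycle_pendants (pendant_counts f [v0, v1, v2, v3, v4] G))"
    using assms by (auto simp: graph_iso_cycle_pendants_iff numeral_eq_Suc)
  ultimately show ?thesis
    unfolding listed_graph_def by metis
qed

lemma listed_graph_paw:
  assumes "finite (pverts G)" and ext: "pendant_extension paw_core [v0, v1, v2, v3] f G"
    and supp: "f ` (pverts G - {v0, v1, v2, v3}) \<subseteq> {v0, v3}"
  shows "listed_graph G"
proof -
  define m t where "m = Suc (card (pendants f [v0, v1, v2, v3] G v0))"
    and "t = card (pendants f [v0, v1, v2, v3] G v3)"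
  have "v1 \<notin> {v0, v3}" "v2 \<notin> {v0, v3}"
    using ext by (auto simp: pendant_extension_def)
  then have "pendant_counts f [v0, v1, v2, v3] G = [m - 1, 0, 0, t]"
    using supp by (simp add: pendant_counts_def pendants_empty m_def t_def)
  then have "graph_iso G (triangle_pendants_ext t m)"
    using assms by (auto simp: graph_iso_triangle_pendants_ext_iff m_def)
  then show ?thesis
    unfolding listed_graph_def m_def by auto
qed

lemma cycle_pendants_quadrangle_cases:
  assumes iso: "graph_iso G (cycle_pendants [n1, n2, 0, 0])"
    and fin: "finite (pverts G)" and n: "card (pverts G) = n"
  shows "graph_iso G (cycle_pendants [n - 4, 0, 0, 0]) \<or>
    (\<exists>n1 n2. n1 \<ge> 1 \<and> n2 \<ge> 1 \<and> n1 + n2 = n - 4 \<and> graph_iso G (cycle_pendants [n1, n2, 0, 0]))"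
proof -
  have sum: "n1 + n2 = n - 4"
    using card_verts_cycle_pendants[OF iso fin] n by simp
  consider (zero_first) "n1 = 0" | (zero_second) "n2 = 0" | (positive) "n1 \<ge> 1" "n2 \<ge> 1"
    by linarith
  then show ?thesis
  proof cases
    case zero_first
    then show ?thesis
      using graph_iso_cycle_pendants_rotate1[OF iso fin] sum by simp
  next
    case zero_second
    then show ?thesis using iso sum by simp
  next
    case positive
    then show ?thesis using iso sum by blast
  qed
qed

lemma triangle_pendants_ext_cases:
  assumes iso: "graph_iso G (triangle_pendants_ext t m)" and m: "m \<ge> 1"
    and fin: "finite (pverts G)" and n: "card (pverts G) = n"
  shows "(\<exists>n1 n2 n3. n1 + n2 + n3 = n - 3 \<and> graph_iso G (cycle_pendants [n1, n2, n3])) \<or>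
    (\<exists>t m. t \<ge> 1 \<and> m \<ge> 1 \<and> m + t = n - 3 \<and> graph_iso G (triangle_pendants_ext t m))"
proof -
  have sum: "m + t = n - 3"
    using card_verts_triangle_pendants_ext[OF iso fin m] n by simp
  show ?thesis
  proof (cases "t = 0")
    case True
    then have "m + 0 + 0 = n - 3 \<and> graph_iso G (cycle_pendants [m, 0, 0])"
      using iso sum by (simp add: triangle_pendants_ext_0)
    then show ?thesis by blast
  next
    case False
    then have "t \<ge> 1" by simp
    then show ?thesis using iso m sum by blast
  qed
qed

lemma listed_graph_cases:
  assumes listed: "listed_graph G" and fin: "finite (pverts G)" and n: "card (pverts G) = n"
  obtains (triangle) "\<exists>n1 n2 n3. n1 + n2 + n3 = n - 3 \<and> graph_iso G (cycle_pendants [n1, n2, n3])"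
    | (quadrangle) "graph_iso G (cycle_pendants [n - 4, 0, 0, 0])"
    | (quadrangle_adjacent)
      "\<exists>n1 n2. n1 \<ge> 1 \<and> n2 \<ge> 1 \<and> n1 + n2 = n - 4 \<and> graph_iso G (cycle_pendants [n1, n2, 0, 0])"
    | (pentagon) "graph_iso G (cycle_pendants [n - 5, 0, 0, 0, 0])"
    | (triangle_ext)
      "\<exists>t m. t \<ge> 1 \<and> m \<ge> 1 \<and> m + t = n - 3 \<and> graph_iso G (triangle_pendants_ext t m)"
proof -
  have "n1 + n2 + n3 = n - 3" if "graph_iso G (cycle_pendants [n1, n2, n3])" for n1 n2 n3
    using card_verts_cycle_pendants[OF that fin] n by simp
  moreover have "m = n - 5" if "graph_iso G (cycle_pendants [m, 0, 0, 0, 0])" for m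
    using card_verts_cycle_pendants[OF that fin] n by simp
  ultimately show thesis
    using listed[unfolded listed_graph_def] that
      cycle_pendants_quadrangle_cases[OF _ fin n] triangle_pendants_ext_cases[OF _ _ fin n]
    by metis
qed

context connected_pair_graph
begin

lemma listed_graph_or_far_arcs_quadrangle:
  assumes ext: "pendant_extension (cycle_core 4) [v0, v1, v2, v3] f G"
    and supp: "f ` (pverts G - set [v0, v1, v2, v3]) \<subseteq> {v0, v1, v2}"
  shows "listed_graph G \<or> card far_arcs \<ge> 4"
proof -
  define S where "S = f ` (pverts G - set [v0, v1, v2, v3])"
  have ext_rotated: "pendant_extension (cycle_core 4) [v1, v2, v3, v0] f G"
    using pendant_extension_rotate1[OF ext] by simp
  have "distinct [v0, v1, v2, v3]"
    using ext by (simp add: pendant_extension_def)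
  then have opposite: "v0 \<noteq> v2" "\<not> adj v0 v2"
    using adj_iff_core_arcs[OF ext, of v0 v2] by (auto simp: core_arcs_simps)
  have "S \<subseteq> {v0, v1, v2}" using supp by (simp only: S_def)
  then consider (v0_v1) "S \<subseteq> {v0, v1}" | (v1_v2) "S \<subseteq> {v1, v2}" | (v0_v2) "v0 \<in> S" "v2 \<in> S"
    by blast
  then show ?thesis
  proof cases
    case v0_v1
    then show ?thesis
      by (intro disjI1 listed_graph_quadrangle[OF pair_finite_verts ext]) (simp add: S_def)
  next
    case v1_v2
    then show ?thesis
      by (intro disjI1 listed_graph_quadrangle[OF pair_finite_verts ext_rotated])
        (simp add: S_def insert_commute)
  next
    case v0_v2
    then show ?thesis
      using opposite unfolding S_def by (intro disjI2 card_far_arcs_ge_4_supports[OF ext])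
  qed
qed

lemma listed_graph_or_far_arcs_pentagon:
  assumes ext: "pendant_extension (cycle_core 5) [v0, v1, v2, v3, v4] f G"
    and supp: "f ` (pverts G - set [v0, v1, v2, v3, v4]) \<subseteq> {v0, v1, v2}"
  shows "listed_graph G \<or> card far_arcs \<ge> 4"
proof -
  define S where "S = f ` (pverts G - set [v0, v1, v2, v3, v4])"
  have ext1: "pendant_extension (cycle_core 5) [v1, v2, v3, v4, v0] f G"
    using pendant_extension_rotate1[OF ext] by simp
  have ext2: "pendant_extension (cycle_core 5) [v2, v3, v4, v0, v1] f G"
    using pendant_extension_rotate1[OF ext1] by simp
  have S: "S = f ` (pverts G - set [v1, v2, v3, v4, v0])"
    "S = f ` (pverts G - set [v2, v3, v4, v0, v1])"
    by (simp_all add: S_def insert_commute)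
  have "distinct [v0, v1, v2, v3, v4]"
    using ext by (simp add: pendant_extension_def)
  then have v0_v2: "v0 \<noteq> v2" "\<not> adj v0 v2"
    using adj_iff_core_arcs[OF ext, of v0 v2] by (auto simp: core_arcs_simps)
  have "S \<subseteq> {v0, v1, v2}" using supp by (simp only: S_def)
  then consider "S \<subseteq> {v0}" | "S \<subseteq> {v1}" | "S \<subseteq> {v2}"
    | "v0 \<in> S" "v1 \<in> S" | "v1 \<in> S" "v2 \<in> S" | "v0 \<in> S" "v2 \<in> S"
    by blast
  then show ?thesis
    using listed_graph_pentagon[OF pair_finite_verts ext]
      listed_graph_pentagon[OF pair_finite_verts ext1]
      listed_graph_pentagon[OF pair_finite_verts ext2]
      card_far_arcs_ge_4_pentagon[OF ext] card_far_arcs_ge_4_pentagon[OF ext1]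
      card_far_arcs_ge_4_supports[OF ext _ _ v0_v2]
    unfolding S_def[symmetric] S[symmetric] list.set[symmetric] by cases blast+
qed

end

section \<open>Depth-two trees with an extra edge\<close>

locale depth_two_graph = connected_pair_graph +
  fixes c :: 'a and p :: "'a \<Rightarrow> 'a" and x y :: 'a
  assumes root: "c \<in> pverts G"
    and depth_two: "v \<in> pverts G - {c} \<Longrightarrow> p v = c \<or> p v \<in> pverts G - {c} \<and> p (p v) = c"
    and arcs: "parcs G = symcl ((\<lambda>v. (p v, v)) ` (pverts G - {c}) \<union> {(x, y)})"
    and extra_verts: "x \<in> pverts G - {c}" "y \<in> pverts G - {c}"
    and extra_not_tree: "p x \<noteq> y" "p y \<noteq> x"
begin

definition children :: "'a set" where
  "children = {v \<in> pverts G - {c}. p v = c}"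

definition grandchildren :: "'a set" where
  "grandchildren = {v \<in> pverts G - {c}. p v \<noteq> c}"

lemma verts: "pverts G = insert c (children \<union> grandchildren)"
  using root by (auto simp: children_def grandchildren_def)

lemma levels_disjoint:
  "c \<notin> children" "c \<notin> grandchildren" "v \<in> children \<Longrightarrow> v \<notin> grandchildren"
  "v \<in> children \<Longrightarrow> v \<noteq> c" "v \<in> children \<Longrightarrow> c \<noteq> v"
  "w \<in> grandchildren \<Longrightarrow> w \<noteq> c" "w \<in> grandchildren \<Longrightarrow> c \<noteq> w"
  "v \<in> children \<Longrightarrow> w \<in> grandchildren \<Longrightarrow> v \<noteq> w"
  "v \<in> children \<Longrightarrow> w \<in> grandchildren \<Longrightarrow> w \<noteq> v"
  by (auto simp: children_def grandchildren_def)

lemma parent_child: "v \<in> children \<Longrightarrow> p v = c"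
  by (simp add: children_def)

lemma parent_grandchild: "v \<in> grandchildren \<Longrightarrow> p v \<in> children"
  using depth_two[of v] by (auto simp: children_def grandchildren_def)

lemma extra_cases: "x \<in> children \<or> x \<in> grandchildren" "y \<in> children \<or> y \<in> grandchildren"
  using extra_verts by (auto simp: verts)

lemma adj_extra: "adj x y"
  unfolding arcs by (simp add: symcl_iff)

lemma extra_neq: "x \<noteq> y"
  using adj_extra by (rule no_loops')

lemma adj_iff:
  "adj u v \<longleftrightarrow> v \<in> pverts G - {c} \<and> u = p v \<or> u \<in> pverts G - {c} \<and> v = p u \<or> {u, v} = {x, y}"
  unfolding arcs symcl_iff by (auto simp: doubleton_eq_iff)

lemma adj_children_iff:
  assumes "u \<in> children" "v \<in> children"
  shows "adj u v \<longleftrightarrow> {u, v} = {x, y}"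
proof -
  have "u \<noteq> p v" "v \<noteq> p u"
    using assms by (simp_all add: parent_child levels_disjoint)
  then show ?thesis by (simp add: adj_iff)
qed

lemma adj_grandchild_iff:
  assumes "w \<in> grandchildren"
  shows "adj w v \<longleftrightarrow> v = p w \<or> {w, v} = {x, y}"
proof -
  have "w \<noteq> p v" if "v \<in> pverts G - {c}" for v
    using that assms by (auto simp: verts parent_child parent_grandchild levels_disjoint)
  then show ?thesis
    using assms by (auto simp: adj_iff grandchildren_def)
qed

lemma pendant_at_parent: "w \<in> grandchildren - {x, y} \<Longrightarrow> pendant_at (p w) w"
  by (auto simp: pendant_at_def adj_grandchild_iff doubleton_eq_iff)

lemma card_far_arcs_ge_4_grandchildren:
  assumes "w \<in> grandchildren - {x, y}" "w' \<in> grandchildren - {x, y}" "p w \<noteq> p w'"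
    and "{p w, p w'} \<noteq> {x, y}"
  shows "card far_arcs \<ge> 4"
  using assms
  by (intro card_far_arcs_ge_4_pendants[OF pendant_at_parent pendant_at_parent, of w w'])
    (auto simp: adj_children_iff parent_grandchild)

lemma pendant_extension_coreI:
  assumes E: "E \<subseteq> {..<k} \<times> {..<k}" and len: "length cs = k"
    and cs: "distinct cs" "set cs = insert c K" "K \<subseteq> children \<union> grandchildren"
    and supports: "p ` grandchildren \<subseteq> insert c K"
    and core: "symcl (core_arcs E cs) = symcl ((\<lambda>v. (p v, v)) ` K \<union> {(x, y)})"
  shows "pendant_extension E cs p G"
proof -
  have "pverts G - {c} = K \<union> (pverts G - set cs)"
    using cs by (auto simp: verts levels_disjoint)
  then have "parcs G = symcl (core_arcs E cs) \<union> symcl ((\<lambda>v. (p v, v)) ` (pverts G - set cs))"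
    unfolding arcs core symcl_Un[symmetric]
    by (intro arg_cong[of _ _ symcl]) (simp add: image_Un Un_ac)
  moreover have "p ` (pverts G - set cs) \<subseteq> set cs" "set cs \<subseteq> pverts G"
    using cs(2,3) supports by (auto simp: verts parent_child)
  ultimately show ?thesis
    using E len cs(1) by (simp add: pendant_extension_def symcl_Un)
qed

lemma card_far_arcs_ge_4_off_core:
  assumes x: "x \<in> grandchildren" and w: "w \<in> grandchildren - {x, y}" "p w \<notin> {p x, y}"
    and y: "y \<in> grandchildren \<Longrightarrow> p w \<noteq> p y"
  shows "card far_arcs \<ge> 4"
proof -
  note pendant = pendant_at_parent[OF w(1)]
  have parents: "p w \<in> children" "p x \<in> children"
    using w x by (simp_all add: parent_grandchild)
  then have "p w \<noteq> x" "w \<noteq> p x"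
    using w x by (auto simp: levels_disjoint)
  have "\<not> adj (p x) (p w)"
    using parents w(2) \<open>p w \<noteq> x\<close> by (auto simp: adj_children_iff doubleton_eq_iff)
  then have "\<not> central (p x)"
    using w parents \<open>w \<noteq> p x\<close> by (intro not_central_if_pendant_at[OF pendant]) (auto simp: verts)
  moreover have "\<not> adj x (p w)"
    using x w(2) by (auto simp: adj_grandchild_iff doubleton_eq_iff)
  then have "\<not> central x"
    using w extra_verts \<open>p w \<noteq> x\<close> by (intro not_central_if_pendant_at[OF pendant]) auto
  moreover have "\<not> adj y (p w)"
    using extra_cases(2) y parents w(2) \<open>p w \<noteq> x\<close>
    by (auto simp: adj_grandchild_iff adj_children_iff doubleton_eq_iff)
  then have "\<not> central y"
    using w extra_verts by (intro not_central_if_pendant_at[OF pendant]) auto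
  moreover have "adj x (p x)"
    using x by (simp add: adj_grandchild_iff)
  ultimately show ?thesis
    using adj_extra extra_not_tree
    by (intro card_far_arcs_ge_4[of x "p x" x y]) (auto simp: far_arcs_def doubleton_eq_iff)
qed

lemma pendant_extension_triangle:
  assumes xy: "x \<in> children" "y \<in> children" and supports: "p ` grandchildren \<subseteq> {x, y}"
  shows "pendant_extension (cycle_core 3) [c, x, y] p G"
  using xy supports extra_neq
  by (intro pendant_extension_coreI[OF cycle_core_subset, where K = "{x, y}"])
    (auto simp: levels_disjoint core_arcs_simps parent_child symcl_def)

lemma pendant_extension_paw_root:
  assumes xy: "x \<in> children" "y \<in> children"
    and u: "u \<in> children" "u \<noteq> x" "u \<noteq> y" and supports: "p ` grandchildren \<subseteq> {u}"
  shows "pendant_extension paw_core [c, x, y, u] p G"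
  using xy u supports extra_neq
  by (intro pendant_extension_coreI[OF paw_core_subset, where K = "{x, y, u}"])
    (auto simp: levels_disjoint core_arcs_simps parent_child symcl_def)

lemma pendant_extension_paw_child:
  assumes xy: "x \<in> grandchildren" "y \<in> grandchildren" "p x = p y"
    and supports: "p ` grandchildren \<subseteq> {p x}"
  shows "pendant_extension paw_core [p x, x, y, c] p G"
  using xy parent_grandchild[OF xy(1)] supports extra_neq
  by (intro pendant_extension_coreI[OF paw_core_subset, where K = "{p x, x, y}"])
    (auto simp: levels_disjoint core_arcs_simps parent_child symcl_def)

lemma pendant_extension_quadrangle:
  assumes xy: "x \<in> grandchildren" "y \<in> children" and supports: "p ` grandchildren \<subseteq> {p x, y}"
  shows "pendant_extension (cycle_core 4) [p x, c, y, x] p G"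
  using xy parent_grandchild[OF xy(1)] supports extra_not_tree
  by (intro pendant_extension_coreI[OF cycle_core_subset, where K = "{p x, y, x}"])
    (auto simp: levels_disjoint core_arcs_simps parent_child symcl_def)

lemma pendant_extension_pentagon:
  assumes xy: "x \<in> grandchildren" "y \<in> grandchildren" "p x \<noteq> p y"
    and supports: "p ` grandchildren \<subseteq> {p x, p y}"
  shows "pendant_extension (cycle_core 5) [p y, c, p x, x, y] p G"
  using xy parent_grandchild[OF xy(1)] parent_grandchild[OF xy(2)] supports extra_neq
  by (intro pendant_extension_coreI[OF cycle_core_subset, where K = "{p y, p x, x, y}"])
    (auto simp: levels_disjoint core_arcs_simps parent_child symcl_def)

lemma listed_graph_or_far_arcs_children:
  assumes xy: "x \<in> children" "y \<in> children"
  shows "listed_graph G \<or> card far_arcs \<ge> 4"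
proof (cases "p ` grandchildren \<subseteq> {x, y}")
  case True
  then show ?thesis
    using listed_graph_triangle[OF pair_finite_verts pendant_extension_triangle] xy by simp
next
  case False
  then obtain w where w: "w \<in> grandchildren" "p w \<notin> {x, y}" by auto
  show ?thesis
  proof (cases "p ` grandchildren \<subseteq> {p w}")
    case True
    then have "pendant_extension paw_core [c, x, y, p w] p G"
      using xy w by (intro pendant_extension_paw_root) (auto simp: parent_grandchild)
    moreover have "p ` (pverts G - {c, x, y, p w}) \<subseteq> {c, p w}"
      using True by (auto simp: verts parent_child)
    ultimately show ?thesis
      by (intro disjI1 listed_graph_paw[OF pair_finite_verts])
  next
    case False
    then obtain w' where "w' \<in> grandchildren" "p w' \<noteq> p w" by auto
    then have "card far_arcs \<ge> 4"
      using w xy by (intro card_far_arcs_ge_4_grandchildren[of w w']) (auto simp: levels_disjoint)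
    then show ?thesis ..
  qed
qed

lemma listed_graph_or_far_arcs_grandchild_child:
  assumes xy: "x \<in> grandchildren" "y \<in> children"
  shows "listed_graph G \<or> card far_arcs \<ge> 4"
proof (cases "p ` grandchildren \<subseteq> {p x, y}")
  case False
  then obtain w where "w \<in> grandchildren" "p w \<noteq> p x" "p w \<noteq> y" by auto
  then have "card far_arcs \<ge> 4"
    using xy by (intro card_far_arcs_ge_4_off_core[of w]) (auto simp: levels_disjoint)
  then show ?thesis ..
next
  case True
  then have "p ` (pverts G - set [p x, c, y, x]) \<subseteq> {p x, c, y}"
    by (auto simp: verts parent_child)
  then show ?thesis
    by (rule listed_graph_or_far_arcs_quadrangle[OF pendant_extension_quadrangle[OF xy True]])
qed

lemma listed_graph_or_far_arcs_siblings:
  assumes xy: "x \<in> grandchildren" "y \<in> grandchildren" "p x = p y"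
  shows "listed_graph G \<or> card far_arcs \<ge> 4"
proof (cases "p ` grandchildren \<subseteq> {p x}")
  case True
  then have "pendant_extension paw_core [p x, x, y, c] p G"
    using xy by (intro pendant_extension_paw_child)
  moreover have "p ` (pverts G - {p x, x, y, c}) \<subseteq> {p x, c}"
    using True by (auto simp: verts parent_child)
  ultimately show ?thesis
    by (intro disjI1 listed_graph_paw[OF pair_finite_verts])
next
  case False
  then obtain w where "w \<in> grandchildren" "p w \<noteq> p x" by auto
  then have "card far_arcs \<ge> 4"
    using xy parent_grandchild[of w]
    by (intro card_far_arcs_ge_4_off_core[of w]) (auto simp: levels_disjoint)
  then show ?thesis ..
qed

lemma listed_graph_or_far_arcs_cousins:
  assumes xy: "x \<in> grandchildren" "y \<in> grandchildren" "p x \<noteq> p y"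
  shows "listed_graph G \<or> card far_arcs \<ge> 4"
proof (cases "p ` grandchildren \<subseteq> {p x, p y}")
  case False
  then obtain w where "w \<in> grandchildren" "p w \<noteq> p x" "p w \<noteq> p y" by auto
  then have "card far_arcs \<ge> 4"
    using xy parent_grandchild[of w]
    by (intro card_far_arcs_ge_4_off_core[of w]) (auto simp: levels_disjoint)
  then show ?thesis ..
next
  case True
  then have "p ` (pverts G - set [p y, c, p x, x, y]) \<subseteq> {p y, c, p x}"
    by (auto simp: verts parent_child)
  then show ?thesis
    by (rule listed_graph_or_far_arcs_pentagon[OF pendant_extension_pentagon[OF xy True]])
qed

lemma depth_two_graph_swap: "depth_two_graph G c p y x"
proof
  show "parcs G = symcl ((\<lambda>v. (p v, v)) ` (pverts G - {c}) \<union> {(y, x)})"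
    unfolding arcs by (auto simp: symcl_def)
qed (use root depth_two extra_verts extra_not_tree in auto)

lemma listed_graph_or_far_arcs: "listed_graph G \<or> card far_arcs \<ge> 4"
proof -
  interpret swap: depth_two_graph G c p y x by (rule depth_two_graph_swap)
  show ?thesis
    using extra_cases listed_graph_or_far_arcs_children
      listed_graph_or_far_arcs_grandchild_child swap.listed_graph_or_far_arcs_grandchild_child
      listed_graph_or_far_arcs_siblings listed_graph_or_far_arcs_cousins by metis
qed

end

section \<open>The upper bound\<close>

context connected_pair_graph
begin

lemma bfs_parent_eq_root_if_adj:
  assumes r: "r \<in> pverts G" and p: "bfs_parent r p" and v: "adj r v"
  shows "p v = r"
proof -
  have "v \<in> pverts G - {r}"
    using v by (auto dest: in_arcsD2 no_loops')
  then have "p v \<in> pverts G" "ndist r v = Suc (ndist r (p v))"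
    using p by (auto simp: bfs_parent_def dest: in_arcsD1)
  then show ?thesis
    using ndist_adj[OF v] ndist_eq_0_iff[OF r] by auto
qed

lemma depth_two_graph_if_central:
  assumes c: "c \<in> pverts G" "central c" and p: "bfs_parent c p"
    and xy: "adj x y" "(x, y) \<notin> tree_arcs c p" "parcs G = tree_arcs c p \<union> {(x, y), (y, x)}"
  shows "depth_two_graph G c p x y"
proof
  have p_iff: "p v \<in> pverts G" "ndist c v = Suc (ndist c (p v))" if "v \<in> pverts G - {c}" for v
    using p that by (auto simp: bfs_parent_def dest: in_arcsD1)
  have "ndist c v \<le> 2" if "v \<in> pverts G" for v
    using c that by (simp add: central_def necc_le_iff)
  then show "p v = c \<or> p v \<in> pverts G - {c} \<and> p (p v) = c" if "v \<in> pverts G - {c}" for v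
    using that p_iff[of v] p_iff[of "p v"] ndist_eq_0_iff[OF c(1), of "p (p v)"] by fastforce
  show "parcs G = symcl ((\<lambda>v. (p v, v)) ` (pverts G - {c}) \<union> {(x, y)})"
    unfolding xy(3) tree_arcs_def by (auto simp: symcl_def)
  have tree: "u = p v \<and> v \<in> pverts G - {c} \<longrightarrow> {u, v} \<noteq> {x, y}" for u v
    using xy(2) by (auto simp: tree_arcs_def symcl_iff doubleton_eq_iff)
  have V: "x \<in> pverts G" "y \<in> pverts G" "x \<noteq> y"
    using xy(1) by (auto dest: in_arcsD1 in_arcsD2 no_loops')
  have "x \<noteq> c"
    using tree[of c y] bfs_parent_eq_root_if_adj[OF c(1) p, of y] xy(1) V by auto
  moreover have "y \<noteq> c"
    using tree[of c x] bfs_parent_eq_root_if_adj[OF c(1) p, of x] adj_sym[OF xy(1)] V by auto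
  ultimately show "x \<in> pverts G - {c}" "y \<in> pverts G - {c}" "p x \<noteq> y" "p y \<noteq> x"
    using V tree[of "p x" x] tree[of "p y" y] by auto
qed (rule c(1))

end

context at_most_unicyclic_graph
begin

lemma listed_graph_or_far_arcs_if_not_tree:
  assumes n: "card (pverts G) \<ge> 3" and arcs: "card (parcs G) > 2 * (card (pverts G) - 1)"
  shows "listed_graph G \<or> card far_arcs \<ge> 4"
proof (cases "\<exists>c\<in>pverts G. central c")
  case True
  then obtain c p where c: "c \<in> pverts G" "central c" and p: "bfs_parent c p"
    using ex_bfs_parent by blast
  show ?thesis
    using spanning_connected_tree_arcs[OF p]
  proof (cases rule: arcs_spanning_cases)
    case tree
    then show ?thesis using card_tree_arcs_le[OF c(1), of p] arcs by simp
  next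
    case (extra x y)
    then interpret depth_two_graph G c p x y
      using c p by (intro depth_two_graph_if_central)
    show ?thesis by (rule listed_graph_or_far_arcs)
  qed
next
  case False
  then have "far_arcs = parcs G"
    by (auto simp: far_arcs_def dest: in_arcsD1 in_arcsD2)
  then show ?thesis using n arcs by auto
qed

lemma ABC3_less_or_listed_graph:
  assumes "card (pverts G) \<ge> 3"
  shows "ABC3 G < unicyclic_bound (card (pverts G)) \<or> listed_graph G"
proof -
  consider "card (parcs G) + 2 \<le> 2 * card (pverts G)" | "card far_arcs \<ge> 4" | "listed_graph G"
    using listed_graph_or_far_arcs_if_not_tree assms by linarith
  then show ?thesis
    using ABC3_less_if_few_arcs ABC3_less_if_far_arcs[OF card_arcs_le] by cases auto
qed

end

lemma at_most_unicyclic_graph_if_unicyclic: "unicyclic G \<Longrightarrow> at_most_unicyclic_graph G"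
  unfolding unicyclic_def
  by (intro at_most_unicyclic_graph.intro connected_pair_graph.intro
      connected_pair_graph_axioms.intro at_most_unicyclic_graph_axioms.intro) auto

theorem theorem3p3:
  fixes G :: "'a pair_pre_digraph" and n :: nat
  assumes "unicyclic G"
    and "card (pverts G) = n"
    and "n \<ge> 6"
    and "\<not> graph_iso G (cycle_pendants [n - 4, 0, 0, 0])"
    and "\<not> (\<exists>n1 n2 n3. n1 + n2 + n3 = n - 3 \<and> graph_iso G (cycle_pendants [n1, n2, n3]))"
  shows "ABC3 G \<le> (real n - 1) * sqrt (1 / 2) + abc_f 3 3 \<and>
    (ABC3 G = (real n - 1) * sqrt (1 / 2) + abc_f 3 3 \<longleftrightarrow>
      graph_iso G (cycle_pendants [n - 5, 0, 0, 0, 0]) \<or>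
      (\<exists>n1 n2. n1 \<ge> 1 \<and> n2 \<ge> 1 \<and> n1 + n2 = n - 4 \<and> graph_iso G (cycle_pendants [n1, n2, 0, 0])) \<or>
      (\<exists>t m. t \<ge> 1 \<and> m \<ge> 1 \<and> m + t = n - 3 \<and> graph_iso G (triangle_pendants_ext t m)))"
    (is "_ \<and> (_ \<longleftrightarrow> ?pentagon \<or> ?quadrangle \<or> ?triangle_ext)")
proof -
  interpret at_most_unicyclic_graph G
    using assms(1) by (rule at_most_unicyclic_graph_if_unicyclic)
  have extremal: "ABC3 G = unicyclic_bound n" if "?pentagon \<or> ?quadrangle \<or> ?triangle_ext"
    using that ABC3_eq_pentagon ABC3_eq_quadrangle ABC3_eq_triangle_ext assms(2,3) by force
  have "?pentagon \<or> ?quadrangle \<or> ?triangle_ext" if "listed_graph G"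
    using that pair_finite_verts assms(2)
    by (cases rule: listed_graph_cases) (use assms(4,5) in simp_all)
  then have "ABC3 G < unicyclic_bound n \<or> ?pentagon \<or> ?quadrangle \<or> ?triangle_ext"
    using ABC3_less_or_listed_graph assms(2,3) by auto
  then show ?thesis
    using extremal unfolding unicyclic_bound_def by argo
qed

end
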